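(* Let $J\in L^2(\Omega)^3$ and let $\alpha^0>0$ and $\alpha^1\neq0$ be arbitrary real stabilization parameters. Then the system: find $p_h\in V^0_h$, $B_h\in V^1_h$ and $z_h\in\bar{\mathcal{H}}^1_h$ such that $$\left\{\begin{aligned} &\langle q,p_h\rangle+\alpha^0\langle(I-\bar P^0_h)q,(I-\bar P^0_h)p_h\rangle+\langle\operatorname{grad}\bar P^0_hq,B_h\rangle=0\\ &\langle v,\operatorname{grad}\bar P^0_hp_h\rangle+\langle\operatorname{curl}\bar P^1_hv,\operatorname{curl}\bar P^1_hB_h\rangle+\alpha^1\langle(I-\bar P^1_h)v,(I-\bar P^1_h)B_h\rangle+\langle v,z_h\rangle=\langle\operatorname{curl}\bar P^1_hv,J\rangle\\ &\langle w,B_h\rangle=0 \end{aligned}\right.$$ for all $q\in V^0_h$, $v\in V^1_h$, $w\in\bar{\mathcal{H}}^1_h$, is well-posed, and its solution satisfies $$B_h\in\bar V^{1,c}_h\cap\big(\bar{\mathcal{H}}^1_h\oplus\operatorname{grad}\bar V^{0,c}_h\big)^\perp,\qquad p_h=0,\qquad z_h=0.$$ Moreover, the discrete magnetic field can be decomposed as $$B_h=B^{\rm g}_h+B^{\rm h}_h+B^{\rm c}_h\in\operatorname{grad}^c_h\bar V^{0,c}_h\overset{\perp}{\oplus}\bar{\mathcal{H}}^1_h\overset{\perp}{\oplus}\widetilde{\operatorname{curl}}^c_h\bar V^{2,c}_h$$ with discrete grad, harmonic and curl components characterized by $$B^{\rm g}_h=0,\qquad B^{\rm h}_h=0,\qquad\langle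 w,\operatorname{curl}B^{\rm c}_h\rangle=\langle w,J\rangle\quad\forall\,w\in\operatorname{curl}\bar V^{1,c}_h.$$ In particular, the solution is independent of the parameters $\alpha^0>0$, $\alpha^1\neq0$, and of the conforming projection operators.
   Context: $\langle\cdot,\cdot\rangle$ is the $L^2(\Omega)$ scalar product, $\perp$ refers to $L^2$-orthogonality, and $\overset{\perp}{\oplus}$ is an $L^2$-orthogonal direct sum. Let $\Omega\subset\mathbb{R}^3$ be a domain decomposed in a partition of open subdomains $\Omega_k$, $k=1,\dots,K$, and consider the inhomogeneous spaces $\bar V^0=H^1(\Omega)$, $\bar V^1=H(\operatorname{curl};\Omega)$, $\bar V^2=H(\operatorname{div};\Omega)$. For each $k$ let $V^0_h(\Omega_k)\subset H^1(\Omega_k)$, $V^1_h(\Omega_k)\subset H(\operatorname{curl};\Omega_k)$, $V^2_h(\Omega_k)\subset H(\operatorname{div};\Omega_k)$ be finite-dimensional spaces (no boundary conditions) with $\operatorname{grad}V^0_h(\Omega_k)\subset V^1_h(\Omega_k)$ and $\operatorname{curl}V^1_h(\Omega_k)\subset V^2_h(\Omega_k)$. The broken spaces are $$V^\ell_h:=\{v\in L^2(\Omega): v|_{\Omega_k}\in V^\ell_h(\Omega_k),\ k=1,\dots,K\}$$ (vector-valued for $\ell=1,2$), and the (inhomogeneous) conforming spaces are $\bar V^{\ell,c}_h:=V^\ell_h\cap\bar V^\ell$; one has $\operatorname{grad}\bar V^{0,c}_h\subset\bar V^{1,c}_h$, $\operatorname{curl}\bar V^{1,c}_h\subset\bar V^{2,c}_h$.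 The conforming projections $\bar P^\ell_h:V^\ell_h\to V^\ell_h$ ($\ell=0,1$) are linear projections with range $\bar V^{\ell,c}_h$. $\operatorname{grad}^c_h:=\operatorname{grad}|_{\bar V^{0,c}_h}$, $\operatorname{curl}^c_h:=\operatorname{curl}|_{\bar V^{1,c}_h}:\bar V^{1,c}_h\to\bar V^{2,c}_h$, and $\widetilde{\operatorname{curl}}^c_h:\bar V^{2,c}_h\to\bar V^{1,c}_h$ is the $L^2$-adjoint of $\operatorname{curl}^c_h$. Discrete harmonic fields: $\bar{\mathcal{H}}^1_h:=\{v\in\bar V^{1,c}_h:\operatorname{curl}v=0\text{ and }\langle\operatorname{grad}q,v\rangle=0\ \forall q\in\bar V^{0,c}_h\}$. The discrete Hodge–Helmholtz decomposition reads $\bar V^{1,c}_h=\operatorname{grad}^c_h\bar V^{0,c}_h\overset{\perp}{\oplus}\bar{\mathcal{H}}^1_h\overset{\perp}{\oplus}\widetilde{\operatorname{curl}}^c_h\bar V^{2,c}_h$. "Well-posed" means existence and uniqueness of the solution for every $J$. *)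

theory Defs
  imports "HOL-Analysis.Analysis"
begin

text \<open>Elements of \<open>'b L2\<close> are classes, modulo equality almost everywhere, of square-integrable
  fields on the whole space. The space \<open>L\<^sup>2(S)\<close> is the subspace \<open>L2_on S\<close> of classes
  vanishing almost everywhere outside \<open>S\<close>, i.e. a field on \<open>S\<close> is identified with its extension
  by zero. The inner product of \<open>'b L2\<close> then restricts to the one of \<open>L\<^sup>2(S)\<close>.\<close>

definition square_integrable :: "(real^3 \<Rightarrow> 'b::euclidean_space) \<Rightarrow> bool" where
  "square_integrable f \<longleftrightarrow>
     f \<in> borel_measurable lebesgue \<and> integrable lebesgue (\<lambda>x. (norm (f x))\<^sup>2)"

definition L2_rel :: "(real^3 \<Rightarrow> 'b::euclidean_space) \<Rightarrow> (real^3 \<Rightarrow> 'b) \<Rightarrow> bool" where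
  "L2_rel f g \<longleftrightarrow> square_integrable f \<and> square_integrable g \<and> (AE x in lebesgue. f x = g x)"

lemma square_integrable_zero: "square_integrable (\<lambda>x. 0)"
  by (simp add: square_integrable_def)

lemma square_integrable_scaleR:
  "square_integrable f \<Longrightarrow> square_integrable (\<lambda>x. c *\<^sub>R f x)"
  by (auto simp: square_integrable_def power_mult_distrib)

lemma square_integrable_add:
  assumes f: "square_integrable f" and g: "square_integrable g"
  shows "square_integrable (\<lambda>x. f x + g x)"
proof -
  have [measurable]: "f \<in> borel_measurable lebesgue" "g \<in> borel_measurable lebesgue"
    using f g by (auto simp: square_integrable_def)
  have "integrable lebesgue (\<lambda>x. 2 * (norm (f x))\<^sup>2 + 2 * (norm (g x))\<^sup>2)"
    using f g by (auto simp: square_integrable_def)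
  then have "integrable lebesgue (\<lambda>x. (norm (f x + g x))\<^sup>2)"
  proof (rule Bochner_Integration.integrable_bound)
    show "AE x in lebesgue. norm ((norm (f x + g x))\<^sup>2)
            \<le> norm (2 * (norm (f x))\<^sup>2 + 2 * (norm (g x))\<^sup>2)"
    proof (rule AE_I2)
      fix x
      have "(norm (f x + g x))\<^sup>2 \<le> (norm (f x) + norm (g x))\<^sup>2"
        by (intro power_mono norm_triangle_ineq) auto
      also have "\<dots> \<le> 2 * (norm (f x))\<^sup>2 + 2 * (norm (g x))\<^sup>2"
        using sum_squares_bound[of "norm (f x)" "norm (g x)"]
        by (simp add: power2_sum)
      finally show "norm ((norm (f x + g x))\<^sup>2) \<le> norm (2 * (norm (f x))\<^sup>2 + 2 * (norm (g x))\<^sup>2)"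
        by simp
    qed
  qed measurable
  then show ?thesis by (simp add: square_integrable_def)
qed

lemma square_integrable_uminus: "square_integrable f \<Longrightarrow> square_integrable (\<lambda>x. - f x)"
  using square_integrable_scaleR[of f "-1"] by simp

lemma square_integrable_diff:
  "square_integrable f \<Longrightarrow> square_integrable g \<Longrightarrow> square_integrable (\<lambda>x. f x - g x)"
  using square_integrable_add[of f "\<lambda>x. - g x"] square_integrable_uminus[of g] by simp

lemma square_integrable_inner:
  assumes f: "square_integrable f" and g: "square_integrable g"
  shows "integrable lebesgue (\<lambda>x. f x \<bullet> g x)"
proof -
  have [measurable]: "f \<in> borel_measurable lebesgue" "g \<in> borel_measurable lebesgue"
    using f g by (auto simp: square_integrable_def)
  have "integrable lebesgue (\<lambda>x. (norm (f x))\<^sup>2 + (norm (g x))\<^sup>2)"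
    using f g by (auto simp: square_integrable_def)
  then show ?thesis
  proof (rule Bochner_Integration.integrable_bound)
    show "AE x in lebesgue. norm (f x \<bullet> g x) \<le> norm ((norm (f x))\<^sup>2 + (norm (g x))\<^sup>2)"
    proof (rule AE_I2)
      fix x
      have "\<bar>f x \<bullet> g x\<bar> \<le> norm (f x) * norm (g x)" by (rule Cauchy_Schwarz_ineq2)
      also have "\<dots> \<le> 2 * norm (f x) * norm (g x)" by (simp add: mult_nonneg_nonneg)
      also have "\<dots> \<le> (norm (f x))\<^sup>2 + (norm (g x))\<^sup>2" by (rule sum_squares_bound)
      finally show "norm (f x \<bullet> g x) \<le> norm ((norm (f x))\<^sup>2 + (norm (g x))\<^sup>2)" by simp
    qed
  qed measurable
qed

quotient_type (overloaded) 'b L2 = "real^3 \<Rightarrow> 'b::euclidean_space" / partial: L2_rel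
proof (rule part_equivpI)
  show "\<exists>f. L2_rel f (f :: real^3 \<Rightarrow> 'b)"
    by (rule exI[of _ "\<lambda>x. 0"]) (simp add: L2_rel_def square_integrable_zero)
  show "symp (L2_rel :: (real^3 \<Rightarrow> 'b) \<Rightarrow> _)"
    by (rule sympI) (auto simp: L2_rel_def)
  show "transp (L2_rel :: (real^3 \<Rightarrow> 'b) \<Rightarrow> _)"
  proof (rule transpI)
    fix f g h :: "real^3 \<Rightarrow> 'b"
    assume "L2_rel f g" "L2_rel g h"
    then have sq: "square_integrable f" "square_integrable h"
      and ae: "AE x in lebesgue. f x = g x" "AE x in lebesgue. g x = h x"
      by (auto simp: L2_rel_def)
    from ae have "AE x in lebesgue. f x = h x" by eventually_elim simp
    with sq show "L2_rel f h" by (simp add: L2_rel_def)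
  qed
qed

instantiation L2 :: (euclidean_space) real_vector
begin

lift_definition zero_L2 :: "'a L2" is "\<lambda>x. 0"
  by (simp add: L2_rel_def square_integrable_zero)

lift_definition plus_L2 :: "'a L2 \<Rightarrow> 'a L2 \<Rightarrow> 'a L2" is "\<lambda>f g x. f x + g x"
  by (clarsimp simp: L2_rel_def square_integrable_add)

lift_definition uminus_L2 :: "'a L2 \<Rightarrow> 'a L2" is "\<lambda>f x. - f x"
  by (clarsimp simp: L2_rel_def square_integrable_uminus)

lift_definition minus_L2 :: "'a L2 \<Rightarrow> 'a L2 \<Rightarrow> 'a L2" is "\<lambda>f g x. f x - g x"
  by (clarsimp simp: L2_rel_def square_integrable_diff)

lift_definition scaleR_L2 :: "real \<Rightarrow> 'a L2 \<Rightarrow> 'a L2" is "\<lambda>c f x. c *\<^sub>R f x"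
  by (clarsimp simp: L2_rel_def square_integrable_scaleR)

instance
  by standard
    (transfer; auto simp: L2_rel_def square_integrable_add square_integrable_scaleR
      square_integrable_diff square_integrable_uminus square_integrable_zero algebra_simps)+

end

instantiation L2 :: (euclidean_space) real_inner
begin

lift_definition inner_L2 :: "'a L2 \<Rightarrow> 'a L2 \<Rightarrow> real" is "\<lambda>f g. \<integral>x. f x \<bullet> g x \<partial>lebesgue"
proof -
  fix f f' g g' :: "real^3 \<Rightarrow> 'a"
  assume "L2_rel f f'" "L2_rel g g'"
  then have sq: "square_integrable f" "square_integrable f'" "square_integrable g"
      "square_integrable g'"
    and ae: "AE x in lebesgue. f x = f' x" "AE x in lebesgue. g x = g' x"
    by (auto simp: L2_rel_def)
  from ae have "AE x in lebesgue. f x \<bullet> g x = f' x \<bullet> g' x"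
    by eventually_elim simp
  then show "(\<integral>x. f x \<bullet> g x \<partial>lebesgue) = (\<integral>x. f' x \<bullet> g' x \<partial>lebesgue)"
    by (intro integral_cong_AE borel_measurable_integrable square_integrable_inner sq)
qed

definition norm_L2 :: "'a L2 \<Rightarrow> real" where "norm_L2 u = sqrt (u \<bullet> u)"
definition dist_L2 :: "'a L2 \<Rightarrow> 'a L2 \<Rightarrow> real" where "dist_L2 u v = norm (u - v)"
definition sgn_L2 :: "'a L2 \<Rightarrow> 'a L2" where "sgn_L2 u = u /\<^sub>R norm u"
definition uniformity_L2 :: "('a L2 \<times> 'a L2) filter" where
  "uniformity_L2 = (INF e\<in>{0<..}. principal {(u, v). dist u v < e})"
definition open_L2 :: "'a L2 set \<Rightarrow> bool" where
  "open_L2 U \<longleftrightarrow> (\<forall>u\<in>U. eventually (\<lambda>(u', v). u' = u \<longrightarrow> v \<in> U) uniformity)"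

instance
proof
  fix u v w :: "'a L2" and r :: real
  show "u \<bullet> v = v \<bullet> u"
    by transfer (simp add: inner_commute)
  show "(u + v) \<bullet> w = u \<bullet> w + v \<bullet> w"
    by transfer (simp add: L2_rel_def inner_add_left square_integrable_inner)
  show "(r *\<^sub>R u) \<bullet> v = r * (u \<bullet> v)"
    by transfer (simp add: L2_rel_def)
  show "0 \<le> u \<bullet> u"
    by transfer simp
  show "u \<bullet> u = 0 \<longleftrightarrow> u = 0"
  proof transfer
    fix f :: "real^3 \<Rightarrow> 'a"
    assume "L2_rel f f"
    then have f: "square_integrable f" by (simp add: L2_rel_def)
    have "(\<integral>x. f x \<bullet> f x \<partial>lebesgue) = 0 \<longleftrightarrow> (AE x in lebesgue. f x \<bullet> f x = 0)"
      using integral_nonneg_eq_0_iff_AE[OF square_integrable_inner[OF f f]] by simp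
    then show "(\<integral>x. f x \<bullet> f x \<partial>lebesgue) = 0 \<longleftrightarrow> L2_rel f (\<lambda>x. 0)"
      using f by (simp add: L2_rel_def square_integrable_zero)
  qed
qed (rule norm_L2_def dist_L2_def sgn_L2_def uniformity_L2_def open_L2_def)+

end

lift_definition supported_on :: "(real^3) set \<Rightarrow> 'b::euclidean_space L2 \<Rightarrow> bool"
  is "\<lambda>S f. AE x in lebesgue. x \<notin> S \<longrightarrow> f x = 0"
proof -
  fix S :: "(real^3) set" and f g :: "real^3 \<Rightarrow> 'b"
  assume "L2_rel f g"
  then have "AE x in lebesgue. f x = g x" by (simp add: L2_rel_def)
  then have "AE x in lebesgue. (x \<notin> S \<longrightarrow> f x = 0) = (x \<notin> S \<longrightarrow> g x = 0)"
    by eventually_elim simp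
  then show "(AE x in lebesgue. x \<notin> S \<longrightarrow> f x = 0) = (AE x in lebesgue. x \<notin> S \<longrightarrow> g x = 0)"
    by (rule eventually_subst)
qed

definition L2_on :: "(real^3) set \<Rightarrow> 'b::euclidean_space L2 set" where
  "L2_on S = {u. supported_on S u}"

text \<open>Restriction to \<open>S\<close>, extended by zero again. Only measurable \<open>S\<close> matter; the other branch
  merely makes the operation total.\<close>

lift_definition restr :: "(real^3) set \<Rightarrow> 'b::euclidean_space L2 \<Rightarrow> 'b L2"
  is "\<lambda>S f x. if S \<in> sets lebesgue \<and> x \<in> S then f x else 0"
proof -
  fix S :: "(real^3) set" and f g :: "real^3 \<Rightarrow> 'b"
  have sq: "square_integrable (\<lambda>x. if S \<in> sets lebesgue \<and> x \<in> S then h x else 0)"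
    if h: "square_integrable h" for h :: "real^3 \<Rightarrow> 'b"
  proof (cases "S \<in> sets lebesgue")
    case True
    have [measurable]: "h \<in> borel_measurable lebesgue" "S \<in> sets lebesgue"
      using h True by (auto simp: square_integrable_def)
    have "integrable lebesgue (\<lambda>x. (norm (if x \<in> S then h x else 0))\<^sup>2)"
      by (rule Bochner_Integration.integrable_bound[of _ "\<lambda>x. (norm (h x))\<^sup>2"])
         (use h in \<open>auto simp: square_integrable_def\<close>)
    then show ?thesis using True by (simp add: square_integrable_def)
  qed (simp add: square_integrable_zero)
  assume "L2_rel f g"
  then show "L2_rel (\<lambda>x. if S \<in> sets lebesgue \<and> x \<in> S then f x else 0)
                    (\<lambda>x. if S \<in> sets lebesgue \<and> x \<in> S then g x else 0)"
    by (clarsimp simp: L2_rel_def sq)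
qed

definition partial_deriv :: "3 \<Rightarrow> (real^3 \<Rightarrow> real) \<Rightarrow> real^3 \<Rightarrow> real" where
  "partial_deriv i f x = frechet_derivative f (at x) (axis i 1)"

primrec Ck :: "nat \<Rightarrow> (real^3 \<Rightarrow> real) \<Rightarrow> bool" where
  "Ck 0 f \<longleftrightarrow> continuous_on UNIV f"
| "Ck (Suc k) f \<longleftrightarrow> (\<forall>x. f differentiable (at x)) \<and> (\<forall>i. Ck k (partial_deriv i f))"

definition test_function :: "(real^3) set \<Rightarrow> (real^3 \<Rightarrow> real) \<Rightarrow> bool" where
  "test_function S \<phi> \<longleftrightarrow>
     (\<forall>k. Ck k \<phi>) \<and> compact (closure {x. \<phi> x \<noteq> 0}) \<and> closure {x. \<phi> x \<noteq> 0} \<subseteq> S"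

definition test_field :: "(real^3) set \<Rightarrow> (real^3 \<Rightarrow> real^3) \<Rightarrow> bool" where
  "test_field S \<phi> \<longleftrightarrow> (\<forall>i. test_function S (\<lambda>x. \<phi> x $ i))"

definition classical_grad :: "(real^3 \<Rightarrow> real) \<Rightarrow> real^3 \<Rightarrow> real^3" where
  "classical_grad \<phi> x = (\<chi> i. partial_deriv i \<phi> x)"

definition classical_div :: "(real^3 \<Rightarrow> real^3) \<Rightarrow> real^3 \<Rightarrow> real" where
  "classical_div \<phi> x = (\<Sum>i\<in>UNIV. partial_deriv i (\<lambda>y. \<phi> y $ i) x)"

definition classical_curl :: "(real^3 \<Rightarrow> real^3) \<Rightarrow> real^3 \<Rightarrow> real^3" where
  "classical_curl \<phi> x = vector
     [partial_deriv 2 (\<lambda>y. \<phi> y $ 3) x - partial_deriv 3 (\<lambda>y. \<phi> y $ 2) x,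
      partial_deriv 3 (\<lambda>y. \<phi> y $ 1) x - partial_deriv 1 (\<lambda>y. \<phi> y $ 3) x,
      partial_deriv 1 (\<lambda>y. \<phi> y $ 2) x - partial_deriv 2 (\<lambda>y. \<phi> y $ 1) x]"

lemma test_function_measurable:
  assumes "test_function S \<phi>"
  shows "\<phi> \<in> borel_measurable lebesgue" "partial_deriv i \<phi> \<in> borel_measurable lebesgue"
proof -
  have *: "f \<in> borel_measurable lebesgue" if "Ck 0 f" for f
    using that by (intro measurable_completion) (simp add: borel_measurable_continuous_onI)
  have "Ck 0 \<phi>" "Ck (Suc 0) \<phi>"
    using assms unfolding test_function_def by blast+
  then show "\<phi> \<in> borel_measurable lebesgue" "partial_deriv i \<phi> \<in> borel_measurable lebesgue"
    by (auto intro!: *)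
qed

lemma borel_measurable_vec_lebesgue:
  fixes f :: "real^3 \<Rightarrow> real^3"
  assumes "\<And>i. (\<lambda>x. f x $ i) \<in> borel_measurable lebesgue"
  shows "f \<in> borel_measurable lebesgue"
  by (subst borel_measurable_euclidean_space) (auto simp: Basis_vec_def inner_axis assms)

lemma test_field_measurable:
  assumes "test_field S \<phi>"
  shows "\<phi> \<in> borel_measurable lebesgue" "classical_div \<phi> \<in> borel_measurable lebesgue"
    "classical_curl \<phi> \<in> borel_measurable lebesgue"
proof -
  have [measurable]: "(\<lambda>x. \<phi> x $ i) \<in> borel_measurable lebesgue"
      "partial_deriv j (\<lambda>x. \<phi> x $ i) \<in> borel_measurable lebesgue" for i j
    using assms test_function_measurable unfolding test_field_def by blast+
  show "\<phi> \<in> borel_measurable lebesgue"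
    by (rule borel_measurable_vec_lebesgue) simp
  show "classical_div \<phi> \<in> borel_measurable lebesgue"
    unfolding classical_div_def[abs_def] by simp
  show "classical_curl \<phi> \<in> borel_measurable lebesgue"
  proof (rule borel_measurable_vec_lebesgue)
    fix i :: 3
    show "(\<lambda>x. classical_curl \<phi> x $ i) \<in> borel_measurable lebesgue"
      using exhaust_3[of i] by (auto simp: classical_curl_def)
  qed
qed

lemma classical_grad_measurable:
  "test_function S \<phi> \<Longrightarrow> classical_grad \<phi> \<in> borel_measurable lebesgue"
  by (rule borel_measurable_vec_lebesgue)
     (simp add: classical_grad_def test_function_measurable(2))

lemma L2_rel_integral_inner_cong:
  assumes "L2_rel f g" "h \<in> borel_measurable lebesgue"
  shows "(\<integral>x. f x \<bullet> h x \<partial>lebesgue) = (\<integral>x. g x \<bullet> h x \<partial>lebesgue)"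
proof (rule integral_cong_AE)
  have [measurable]: "f \<in> borel_measurable lebesgue" "g \<in> borel_measurable lebesgue"
      "h \<in> borel_measurable lebesgue"
    using assms by (auto simp: L2_rel_def square_integrable_def)
  show "(\<lambda>x. f x \<bullet> h x) \<in> borel_measurable lebesgue"
       "(\<lambda>x. g x \<bullet> h x) \<in> borel_measurable lebesgue" by measurable
  have "AE x in lebesgue. f x = g x" using assms by (simp add: L2_rel_def)
  then show "AE x in lebesgue. f x \<bullet> h x = g x \<bullet> h x" by eventually_elim simp
qed

text \<open>Test functions vanish outside \<open>S\<close>, so the integrals below are integrals over \<open>S\<close>.\<close>

lift_definition has_weak_grad :: "(real^3) set \<Rightarrow> real L2 \<Rightarrow> (real^3) L2 \<Rightarrow> bool"
  is "\<lambda>S u g. \<forall>\<phi>. test_field S \<phi> \<longrightarrow>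
        (\<integral>x. u x \<bullet> classical_div \<phi> x \<partial>lebesgue) = - (\<integral>x. g x \<bullet> \<phi> x \<partial>lebesgue)"
  by (simp add: test_field_measurable cong: imp_cong L2_rel_integral_inner_cong)

lift_definition has_weak_curl :: "(real^3) set \<Rightarrow> (real^3) L2 \<Rightarrow> (real^3) L2 \<Rightarrow> bool"
  is "\<lambda>S u c. \<forall>\<phi>. test_field S \<phi> \<longrightarrow>
        (\<integral>x. u x \<bullet> classical_curl \<phi> x \<partial>lebesgue) = (\<integral>x. c x \<bullet> \<phi> x \<partial>lebesgue)"
  by (simp add: test_field_measurable cong: imp_cong L2_rel_integral_inner_cong)

lift_definition has_weak_div :: "(real^3) set \<Rightarrow> (real^3) L2 \<Rightarrow> real L2 \<Rightarrow> bool"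
  is "\<lambda>S u d. \<forall>\<phi>. test_function S \<phi> \<longrightarrow>
        (\<integral>x. u x \<bullet> classical_grad \<phi> x \<partial>lebesgue) = - (\<integral>x. d x \<bullet> \<phi> x \<partial>lebesgue)"
  by (simp add: test_function_measurable(1) classical_grad_measurable
      cong: imp_cong L2_rel_integral_inner_cong)

definition H1 :: "(real^3) set \<Rightarrow> real L2 set" where
  "H1 S = {u \<in> L2_on S. \<exists>g\<in>L2_on S. has_weak_grad S u g}"

definition Hcurl :: "(real^3) set \<Rightarrow> (real^3) L2 set" where
  "Hcurl S = {u \<in> L2_on S. \<exists>c\<in>L2_on S. has_weak_curl S u c}"

definition Hdiv :: "(real^3) set \<Rightarrow> (real^3) L2 set" where
  "Hdiv S = {u \<in> L2_on S. \<exists>d\<in>L2_on S. has_weak_div S u d}"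

text \<open>Weak derivatives are unique in \<open>L2_on S\<close>, so the descriptions below are proper for
  \<open>u \<in> H1 S\<close>, respectively \<open>u \<in> Hcurl S\<close>; elsewhere the values are meaningless.\<close>

definition grad :: "(real^3) set \<Rightarrow> real L2 \<Rightarrow> (real^3) L2" where
  "grad S u = (THE g. g \<in> L2_on S \<and> has_weak_grad S u g)"

definition curl :: "(real^3) set \<Rightarrow> (real^3) L2 \<Rightarrow> (real^3) L2" where
  "curl S u = (THE c. c \<in> L2_on S \<and> has_weak_curl S u c)"

definition is_domain :: "(real^3) set \<Rightarrow> bool" where
  "is_domain S \<longleftrightarrow> open S \<and> connected S \<and> S \<noteq> {}"

text \<open>The interfaces between subdomains are only required to have measure zero. For an open
  \<open>\<Omega>\<close> this implies that the closures of the subdomains cover \<open>\<Omega>\<close>.\<close>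

definition subdomain_partition :: "(real^3) set \<Rightarrow> nat \<Rightarrow> (nat \<Rightarrow> (real^3) set) \<Rightarrow> bool" where
  "subdomain_partition \<Omega> K D \<longleftrightarrow>
     (\<forall>k\<in>{1..K}. is_domain (D k) \<and> D k \<subseteq> \<Omega>) \<and>
     disjoint_family_on D {1..K} \<and>
     negligible (\<Omega> - (\<Union>k\<in>{1..K}. D k))"

definition finite_dim_subspace :: "'v::real_vector set \<Rightarrow> bool" where
  "finite_dim_subspace V \<longleftrightarrow> (\<exists>B. finite B \<and> span B = V)"

definition broken_space ::
    "(real^3) set \<Rightarrow> nat \<Rightarrow> (nat \<Rightarrow> (real^3) set) \<Rightarrow> (nat \<Rightarrow> 'b::euclidean_space L2 set) \<Rightarrow> 'b L2 set" where
  "broken_space \<Omega> K D V = {v \<in> L2_on \<Omega>. \<forall>k\<in>{1..K}. restr (D k) v \<in> V k}"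

definition linear_projection :: "'v::real_vector set \<Rightarrow> 'v set \<Rightarrow> ('v \<Rightarrow> 'v) \<Rightarrow> bool" where
  "linear_projection V U P \<longleftrightarrow>
     (\<forall>u\<in>V. \<forall>v\<in>V. P (u + v) = P u + P v) \<and>
     (\<forall>c. \<forall>v\<in>V. P (c *\<^sub>R v) = c *\<^sub>R P v) \<and>
     (\<forall>v\<in>V. P (P v) = P v) \<and>
     P ` V = U"

text \<open>For finite-dimensional \<open>U\<close> and \<open>A\<close> linear on \<open>U\<close>, the description below is
  satisfied by exactly one \<open>t\<close>, and \<open>adjoint_on U A\<close> is the \<open>L\<^sup>2\<close>-adjoint of \<open>A : U \<rightarrow> W\<close> on any
  \<open>W \<supseteq> A ` U\<close>.\<close>

definition adjoint_on :: "'u::real_inner set \<Rightarrow> ('u \<Rightarrow> 'v::real_inner) \<Rightarrow> 'v \<Rightarrow> 'u" where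
  "adjoint_on U A w = (THE t. t \<in> U \<and> (\<forall>v\<in>U. t \<bullet> v = w \<bullet> A v))"

definition harmonic_fields ::
    "(real^3) set \<Rightarrow> real L2 set \<Rightarrow> (real^3) L2 set \<Rightarrow> (real^3) L2 set" where
  "harmonic_fields \<Omega> V0c V1c = {v \<in> V1c. curl \<Omega> v = 0 \<and> (\<forall>q\<in>V0c. grad \<Omega> q \<bullet> v = 0)}"

definition orthogonal_sets :: "'v::real_inner set \<Rightarrow> 'v set \<Rightarrow> bool" where
  "orthogonal_sets U W \<longleftrightarrow> (\<forall>u\<in>U. \<forall>w\<in>W. orthogonal u w)"

definition magnetostatic_solution ::
    "(real^3) set \<Rightarrow> real L2 set \<Rightarrow> (real^3) L2 set \<Rightarrow> (real^3) L2 set \<Rightarrow> (real^3) L2 \<Rightarrow>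
     real \<Rightarrow> real \<Rightarrow> (real L2 \<Rightarrow> real L2) \<Rightarrow> ((real^3) L2 \<Rightarrow> (real^3) L2) \<Rightarrow>
     real L2 \<times> (real^3) L2 \<times> (real^3) L2 \<Rightarrow> bool" where
  "magnetostatic_solution \<Omega> V0h V1h H J \<alpha>0 \<alpha>1 P0 P1 = (\<lambda>(p, B, z).
     p \<in> V0h \<and> B \<in> V1h \<and> z \<in> H \<and>
     (\<forall>q\<in>V0h. q \<bullet> p + \<alpha>0 * ((q - P0 q) \<bullet> (p - P0 p)) + grad \<Omega> (P0 q) \<bullet> B = 0) \<and>
     (\<forall>v\<in>V1h. v \<bullet> grad \<Omega> (P0 p) + curl \<Omega> (P1 v) \<bullet> curl \<Omega> (P1 B)
         + \<alpha>1 * ((v - P1 v) \<bullet> (B - P1 B)) + v \<bullet> z = curl \<Omega> (P1 v) \<bullet> J) \<and>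
     (\<forall>w\<in>H. w \<bullet> B = 0))"

end

theory Submission
  imports Defs
begin

text \<open>Let \<open>(p, B, z)\<close> be a solution. Testing the second equation with \<open>grad (P0 p)\<close> and then
  with \<open>z\<close> kills both, because a gradient and a harmonic field have no curl and are orthogonal;
  the first equation then gives \<open>p = 0\<close>, and testing with \<open>B - P1 B\<close> shows that \<open>B\<close> is conforming.
  What remains does not mention the parameters or the projections: \<open>B\<close> is orthogonal to the kernel of
  the curl, which is the sum of the gradients and the harmonic fields, and \<open>curl B\<close> is the projection
  of \<open>J\<close> onto the discrete curls. In finite dimension exactly one field has these properties.

  The discrete spaces form a complex because weak derivatives in \<open>L\<^sup>2\<close> are unique, which is the
  fundamental lemma of the calculus of variations, because they restrict to subdomains, and because
  mixed partial derivatives of test functions commute.\<close>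

section \<open>Smooth functions and test functions\<close>

text \<open>\<open>grad\<close> and \<open>curl\<close> are definite descriptions, so even their
  linearity is out of reach until weak derivatives are known to be unique, and uniqueness requires a
  supply of test functions that satisfy \<open>Ck k\<close> for every k. This is why explicit bump
  functions are constructed before any functional analysis. Even then the operators are linear only
  on the spaces where weak derivatives exist, so the algebra is carried out relative to subspaces.
  Finite dimension takes the place of completeness: orthogonal projections, the discrete adjoint and
  preimages under that adjoint all come from one representation lemma,
  \<open>finite_dim_subspace_riesz\<close>. The order of the tests in the uniqueness argument
  matters. The field \<open>B - P1 B\<close> is not conforming, so it also meets the terms with
  \<open>grad \<Omega> (P0 p)\<close> and z; these have to be gone before it can be used.\<close>

definition smooth :: "(real^3 \<Rightarrow> real) \<Rightarrow> bool" where
  "smooth f \<longleftrightarrow> (\<forall>k. Ck k f)"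

text \<open>A class of differentiable functions that is closed under partial derivatives lies in
  every \<open>Ck k\<close>, by induction on k for all its members at once. Smoothness can then be
  shown by naming such a class, without formulas for higher derivatives.\<close>

lemma smooth_coinduct [consumes 1, case_names differentiable partial]:
  assumes "X f"
    and diff: "\<And>f x. X f \<Longrightarrow> f differentiable (at x)"
    and part: "\<And>f i. X f \<Longrightarrow> X (partial_deriv i f)"
  shows "smooth f"
proof -
  have "\<forall>f. X f \<longrightarrow> Ck k f" for k
  proof (induction k)
    case 0
    then show ?case
      using diff by (auto simp: continuous_on_eq_continuous_at differentiable_imp_continuous_within)
  next
    case (Suc k)
    then show ?case using diff part by auto
  qed
  with \<open>X f\<close> show ?thesis by (simp add: smooth_def)
qed

lemma smooth_differentiable: "smooth f \<Longrightarrow> f differentiable (at x)"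
  unfolding smooth_def by (metis Ck.simps(2))

lemma smooth_partial_deriv: "smooth f \<Longrightarrow> smooth (partial_deriv i f)"
  unfolding smooth_def by (metis Ck.simps(2))

lemma smooth_continuous_on: "smooth f \<Longrightarrow> continuous_on A f"
  unfolding smooth_def by (metis Ck.simps(1) continuous_on_subset subset_UNIV)

section \<open>Calculus of partial derivatives\<close>

lemma partial_deriv_eq:
  "(f has_derivative f') (at x) \<Longrightarrow> partial_deriv i f x = f' (axis i 1)"
  unfolding partial_deriv_def by (simp add: frechet_derivative_at[symmetric])

lemma partial_deriv_add:
  assumes "\<And>x. f differentiable (at x)" "\<And>x. g differentiable (at x)"
  shows "partial_deriv i (\<lambda>x. f x + g x) = (\<lambda>x. partial_deriv i f x + partial_deriv i g x)"
proof
  fix x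
  show "partial_deriv i (\<lambda>x. f x + g x) x = partial_deriv i f x + partial_deriv i g x"
    using assms[of x] unfolding frechet_derivative_works partial_deriv_def[of i f] partial_deriv_def[of i g]
    by (subst partial_deriv_eq[OF has_derivative_add]) auto
qed

lemma partial_deriv_diff:
  assumes "\<And>x. f differentiable (at x)" "\<And>x. g differentiable (at x)"
  shows "partial_deriv i (\<lambda>x. f x - g x) = (\<lambda>x. partial_deriv i f x - partial_deriv i g x)"
proof
  fix x
  show "partial_deriv i (\<lambda>x. f x - g x) x = partial_deriv i f x - partial_deriv i g x"
    using assms[of x] unfolding frechet_derivative_works partial_deriv_def[of i f] partial_deriv_def[of i g]
    by (subst partial_deriv_eq[OF has_derivative_diff]) auto
qed

lemma partial_deriv_mult:
  assumes "\<And>x. f differentiable (at x)" "\<And>x. g differentiable (at x)"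
  shows "partial_deriv i (\<lambda>x. f x * g x) = (\<lambda>x. f x * partial_deriv i g x + partial_deriv i f x * g x)"
proof
  fix x
  show "partial_deriv i (\<lambda>x. f x * g x) x = f x * partial_deriv i g x + partial_deriv i f x * g x"
    using assms[of x] unfolding frechet_derivative_works partial_deriv_def[of i f] partial_deriv_def[of i g]
    by (subst partial_deriv_eq[OF has_derivative_mult]) auto
qed

lemma partial_deriv_const [simp]: "partial_deriv i (\<lambda>x. c) = (\<lambda>x. 0)"
  by (rule ext, subst partial_deriv_eq[OF has_derivative_const]) simp

lemma smooth_const: "smooth (\<lambda>x. c)"
  by (rule smooth_coinduct[where X = "\<lambda>f. \<exists>c. f = (\<lambda>x. c)"]) auto

lemma smooth_add:
  assumes "smooth f" "smooth g"
  shows "smooth (\<lambda>x. f x + g x)"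
proof (rule smooth_coinduct[where X = "\<lambda>h. \<exists>f g. h = (\<lambda>x. f x + g x) \<and> smooth f \<and> smooth g"])
  show "\<exists>f' g'. (\<lambda>x. f x + g x) = (\<lambda>x. f' x + g' x) \<and> smooth f' \<and> smooth g'"
    using assms by blast
next
  fix h :: "real^3 \<Rightarrow> real" and x
  assume "\<exists>f g. h = (\<lambda>x. f x + g x) \<and> smooth f \<and> smooth g"
  then show "h differentiable (at x)"
    using smooth_differentiable differentiable_add by blast
next
  fix h :: "real^3 \<Rightarrow> real" and i
  assume "\<exists>f g. h = (\<lambda>x. f x + g x) \<and> smooth f \<and> smooth g"
  then obtain f g where "h = (\<lambda>x. f x + g x)" "smooth f" "smooth g" by blast
  then have "partial_deriv i h = (\<lambda>x. partial_deriv i f x + partial_deriv i g x)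
      \<and> smooth (partial_deriv i f) \<and> smooth (partial_deriv i g)"
    by (simp add: partial_deriv_add smooth_differentiable smooth_partial_deriv)
  then show "\<exists>f g. partial_deriv i h = (\<lambda>x. f x + g x) \<and> smooth f \<and> smooth g" by blast
qed

lemma smooth_diff:
  assumes "smooth f" "smooth g"
  shows "smooth (\<lambda>x. f x - g x)"
proof (rule smooth_coinduct[where X = "\<lambda>h. \<exists>f g. h = (\<lambda>x. f x - g x) \<and> smooth f \<and> smooth g"])
  show "\<exists>f' g'. (\<lambda>x. f x - g x) = (\<lambda>x. f' x - g' x) \<and> smooth f' \<and> smooth g'"
    using assms by blast
next
  fix h :: "real^3 \<Rightarrow> real" and x
  assume "\<exists>f g. h = (\<lambda>x. f x - g x) \<and> smooth f \<and> smooth g"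
  then show "h differentiable (at x)"
    using smooth_differentiable differentiable_diff by blast
next
  fix h :: "real^3 \<Rightarrow> real" and i
  assume "\<exists>f g. h = (\<lambda>x. f x - g x) \<and> smooth f \<and> smooth g"
  then obtain f g where "h = (\<lambda>x. f x - g x)" "smooth f" "smooth g" by blast
  then have "partial_deriv i h = (\<lambda>x. partial_deriv i f x - partial_deriv i g x)
      \<and> smooth (partial_deriv i f) \<and> smooth (partial_deriv i g)"
    by (simp add: partial_deriv_diff smooth_differentiable smooth_partial_deriv)
  then show "\<exists>f g. partial_deriv i h = (\<lambda>x. f x - g x) \<and> smooth f \<and> smooth g" by blast
qed

section \<open>Symmetry of mixed partial derivatives\<close>

lemma has_real_derivative_along_axis:
  assumes "f differentiable (at (y + s *\<^sub>R axis i 1))"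
  shows "((\<lambda>t. f (y + t *\<^sub>R axis i 1)) has_real_derivative partial_deriv i f (y + s *\<^sub>R axis i 1)) (at s)"
proof -
  let ?D = "frechet_derivative f (at (y + s *\<^sub>R axis i 1))"
  have f: "(f has_derivative ?D) (at (y + s *\<^sub>R axis i 1))"
    using assms frechet_derivative_works by blast
  have "((\<lambda>t. y + t *\<^sub>R axis i 1) has_derivative (\<lambda>t. t *\<^sub>R axis i (1::real))) (at s)"
    by (auto intro!: derivative_eq_intros)
  then have "((\<lambda>t. f (y + t *\<^sub>R axis i 1)) has_derivative (\<lambda>t. ?D (t *\<^sub>R axis i 1))) (at s)"
    by (rule has_derivative_compose) (rule f)
  moreover have "(\<lambda>t. ?D (t *\<^sub>R axis i 1)) = (*) (partial_deriv i f (y + s *\<^sub>R axis i 1))"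
    using has_derivative_linear[OF f] by (auto simp: partial_deriv_def linear_cmul)
  ultimately show ?thesis by (simp add: has_field_derivative_def)
qed

text \<open>The mean value theorem is applied twice: in direction i to the difference of two
  parallel lines of values, then in direction j to the partial derivative that results. The second
  difference is symmetric in i and j while the right-hand side is not, and this yields Schwarz's
  theorem.\<close>

lemma second_difference_mean_value:
  assumes "smooth f" "h > 0"
  shows "\<exists>s t. 0 < s \<and> s < h \<and> 0 < t \<and> t < h \<and>
    f (x + h *\<^sub>R axis i 1 + h *\<^sub>R axis j 1) - f (x + h *\<^sub>R axis i 1) - f (x + h *\<^sub>R axis j 1) + f x
     = h * h * partial_deriv j (partial_deriv i f) (x + s *\<^sub>R axis i 1 + t *\<^sub>R axis j 1)"
proof -
  let ?i = "axis i 1 :: real^3" and ?j = "axis j 1 :: real^3"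
  let ?\<phi> = "\<lambda>s. f (x + h *\<^sub>R ?j + s *\<^sub>R ?i) - f (x + s *\<^sub>R ?i)"
  let ?\<phi>' = "\<lambda>s. partial_deriv i f (x + h *\<^sub>R ?j + s *\<^sub>R ?i) - partial_deriv i f (x + s *\<^sub>R ?i)"
  have "(?\<phi> has_real_derivative ?\<phi>' s) (at s)" for s
    by (intro DERIV_diff has_real_derivative_along_axis smooth_differentiable assms)
  then obtain s where s: "0 < s" "s < h" "?\<phi> h - ?\<phi> 0 = (h - 0) * ?\<phi>' s"
    using MVT2[of 0 h ?\<phi> ?\<phi>'] \<open>h > 0\<close> by auto
  let ?\<psi> = "\<lambda>t. partial_deriv i f (x + s *\<^sub>R ?i + t *\<^sub>R ?j)"
  let ?\<psi>' = "\<lambda>t. partial_deriv j (partial_deriv i f) (x + s *\<^sub>R ?i + t *\<^sub>R ?j)"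
  have "(?\<psi> has_real_derivative ?\<psi>' t) (at t)" for t
    by (intro has_real_derivative_along_axis smooth_differentiable smooth_partial_deriv assms)
  then obtain t where t: "0 < t" "t < h" "?\<psi> h - ?\<psi> 0 = (h - 0) * ?\<psi>' t"
    using MVT2[of 0 h ?\<psi> ?\<psi>'] \<open>h > 0\<close> by auto
  have "?\<phi>' s = ?\<psi> h - ?\<psi> 0" by (simp add: algebra_simps)
  with s t have "?\<phi> h - ?\<phi> 0 = h * h * ?\<psi>' t" by simp
  moreover have "?\<phi> h - ?\<phi> 0 = f (x + h *\<^sub>R ?i + h *\<^sub>R ?j) - f (x + h *\<^sub>R ?i) - f (x + h *\<^sub>R ?j) + f x"
    by (simp add: algebra_simps)
  ultimately show ?thesis using s t by metis
qed

text \<open>The intermediate points of the mean value theorem lie in squares that shrink to the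
  corner x.\<close>

lemma tendsto_near_corner:
  fixes f :: "real^3 \<Rightarrow> real"
  assumes "continuous_on UNIV f"
    and s: "\<And>n. 0 < s n \<and> s n < 1 / real (Suc n)" and t: "\<And>n. 0 < t n \<and> t n < 1 / real (Suc n)"
  shows "(\<lambda>n. f (x + s n *\<^sub>R u + t n *\<^sub>R v)) \<longlonglongrightarrow> f x"
proof -
  have z: "r \<longlonglongrightarrow> 0" if "\<And>n. 0 < r n \<and> r n < 1 / real (Suc n)" for r :: "nat \<Rightarrow> real"
  proof (rule tendsto_sandwich[OF _ _ tendsto_const])
    show "(\<lambda>n. 1 / real (Suc n)) \<longlonglongrightarrow> 0" by (rule LIMSEQ_Suc[OF lim_1_over_n])
  qed (use that less_imp_le in \<open>auto intro!: always_eventually\<close>)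
  have "(\<lambda>n. x + s n *\<^sub>R u + t n *\<^sub>R v) \<longlonglongrightarrow> x + 0 *\<^sub>R u + 0 *\<^sub>R v"
    by (intro tendsto_intros z s t)
  then show ?thesis
    using assms(1) by (auto simp: continuous_on_eq_continuous_at intro: isCont_tendsto_compose)
qed

text \<open>In every square at x the two mixed derivatives agree, though at different points.
  Letting the squares shrink, continuity moves both points to x.\<close>

lemma partial_deriv_commute:
  assumes "smooth f"
  shows "partial_deriv i (partial_deriv j f) = partial_deriv j (partial_deriv i f)"
proof
  fix x
  let ?h = "\<lambda>n. 1 / real (Suc n)"
  have "\<exists>s t s' t'. (0 < s \<and> s < h) \<and> (0 < t \<and> t < h) \<and> (0 < s' \<and> s' < h) \<and> (0 < t' \<and> t' < h) \<and>
     partial_deriv j (partial_deriv i f) (x + s *\<^sub>R axis i 1 + t *\<^sub>R axis j 1) =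
     partial_deriv i (partial_deriv j f) (x + s' *\<^sub>R axis j 1 + t' *\<^sub>R axis i 1)" if "h > 0" for h
  proof -
    obtain s t where st: "0 < s" "s < h" "0 < t" "t < h"
      "f (x + h *\<^sub>R axis i 1 + h *\<^sub>R axis j 1) - f (x + h *\<^sub>R axis i 1) - f (x + h *\<^sub>R axis j 1) + f x
     = h * h * partial_deriv j (partial_deriv i f) (x + s *\<^sub>R axis i 1 + t *\<^sub>R axis j 1)" (is "_ = _ * ?a")
      using second_difference_mean_value[OF assms \<open>h > 0\<close>, of x i j] by blast
    obtain s' t' where st': "0 < s'" "s' < h" "0 < t'" "t' < h"
      "f (x + h *\<^sub>R axis j 1 + h *\<^sub>R axis i 1) - f (x + h *\<^sub>R axis j 1) - f (x + h *\<^sub>R axis i 1) + f x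
     = h * h * partial_deriv i (partial_deriv j f) (x + s' *\<^sub>R axis j 1 + t' *\<^sub>R axis i 1)" (is "_ = _ * ?b")
      using second_difference_mean_value[OF assms \<open>h > 0\<close>, of x j i] by blast
    have "x + h *\<^sub>R axis j 1 + h *\<^sub>R axis i 1 = x + h *\<^sub>R axis i 1 + h *\<^sub>R axis j 1"
      by (simp add: algebra_simps)
    with st(5) st'(5) have "h * h * ?a = h * h * ?b" by (simp only:)
    then have "?a = ?b" using \<open>h > 0\<close> by simp
    with st(1-4) st'(1-4) show ?thesis by blast
  qed
  then have "\<exists>s t s' t'. (0 < s \<and> s < ?h n) \<and> (0 < t \<and> t < ?h n) \<and> (0 < s' \<and> s' < ?h n) \<and> (0 < t' \<and> t' < ?h n) \<and>
     partial_deriv j (partial_deriv i f) (x + s *\<^sub>R axis i 1 + t *\<^sub>R axis j 1) =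
     partial_deriv i (partial_deriv j f) (x + s' *\<^sub>R axis j 1 + t' *\<^sub>R axis i 1)" for n
    by simp
  then obtain s t s' t' where
    st: "\<And>n. 0 < s n \<and> s n < ?h n" "\<And>n. 0 < t n \<and> t n < ?h n"
      "\<And>n. 0 < s' n \<and> s' n < ?h n" "\<And>n. 0 < t' n \<and> t' n < ?h n"
    and eq: "\<And>n. partial_deriv j (partial_deriv i f) (x + s n *\<^sub>R axis i 1 + t n *\<^sub>R axis j 1) =
     partial_deriv i (partial_deriv j f) (x + s' n *\<^sub>R axis j 1 + t' n *\<^sub>R axis i 1)"
    by metis
  have c: "continuous_on UNIV (partial_deriv a (partial_deriv b f))" for a b
    by (intro smooth_continuous_on smooth_partial_deriv assms)
  show "partial_deriv i (partial_deriv j f) x = partial_deriv j (partial_deriv i f) x"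
    using tendsto_near_corner[OF c st(3,4), of i j x "axis j 1" "axis i 1"]
      tendsto_near_corner[OF c st(1,2), of j i x "axis i 1" "axis j 1"] LIMSEQ_unique
    unfolding eq by blast
qed

section \<open>Test functions, their derivatives and the identities div curl = 0 and curl grad =
  0\<close>

lemma test_function_iff:
  "test_function S \<phi> \<longleftrightarrow>
    smooth \<phi> \<and> compact (closure {x. \<phi> x \<noteq> 0}) \<and> closure {x. \<phi> x \<noteq> 0} \<subseteq> S"
  by (simp add: test_function_def smooth_def)

text \<open>Avoids computing supports: trapping the nonzero set in a compact subset of S is enough,
  because a closed subset of a compact set is compact.\<close>

lemma test_function_subset_support:
  assumes "smooth \<phi>" "{x. \<phi> x \<noteq> 0} \<subseteq> C" "compact C" "C \<subseteq> S"
  shows "test_function S \<phi>"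
proof -
  have "closure {x. \<phi> x \<noteq> 0} \<subseteq> C"
    using assms by (simp add: closure_minimal compact_imp_closed)
  then show ?thesis
    using assms compact_Int_closed[of C "closure {x. \<phi> x \<noteq> 0}"]
    by (auto simp: test_function_iff Int_absorb1)
qed

lemma test_function_add:
  assumes "test_function S \<phi>" "test_function S \<psi>"
  shows "test_function S (\<lambda>x. \<phi> x + \<psi> x)"
proof (rule test_function_subset_support)
  have "{x. \<phi> x + \<psi> x \<noteq> 0} \<subseteq> {x. \<phi> x \<noteq> 0} \<union> {x. \<psi> x \<noteq> 0}" by auto
  then show "{x. \<phi> x + \<psi> x \<noteq> 0} \<subseteq> closure {x. \<phi> x \<noteq> 0} \<union> closure {x. \<psi> x \<noteq> 0}"
    using Un_mono[OF closure_subset closure_subset] by (rule order_trans)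
qed (use assms in \<open>auto simp: test_function_iff smooth_add\<close>)

lemma test_function_diff:
  assumes "test_function S \<phi>" "test_function S \<psi>"
  shows "test_function S (\<lambda>x. \<phi> x - \<psi> x)"
proof (rule test_function_subset_support)
  have "{x. \<phi> x - \<psi> x \<noteq> 0} \<subseteq> {x. \<phi> x \<noteq> 0} \<union> {x. \<psi> x \<noteq> 0}" by auto
  then show "{x. \<phi> x - \<psi> x \<noteq> 0} \<subseteq> closure {x. \<phi> x \<noteq> 0} \<union> closure {x. \<psi> x \<noteq> 0}"
    using Un_mono[OF closure_subset closure_subset] by (rule order_trans)
qed (use assms in \<open>auto simp: test_function_iff smooth_diff\<close>)

lemma test_function_mono: "test_function S \<phi> \<Longrightarrow> S \<subseteq> T \<Longrightarrow> test_function T \<phi>"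
  unfolding test_function_iff by (meson order_trans)

lemma test_field_mono: "test_field S \<phi> \<Longrightarrow> S \<subseteq> T \<Longrightarrow> test_field T \<phi>"
  by (simp add: test_field_def test_function_mono[of S _ T])

lemma test_function_partial_deriv:
  assumes "test_function S \<phi>"
  shows "test_function S (partial_deriv i \<phi>)"
proof (rule test_function_subset_support)
  show "{x. partial_deriv i \<phi> x \<noteq> 0} \<subseteq> closure {x. \<phi> x \<noteq> 0}"
  proof (rule subsetI, rule ccontr)
    fix x
    assume x: "x \<in> {x. partial_deriv i \<phi> x \<noteq> 0}" "x \<notin> closure {x. \<phi> x \<noteq> 0}"
    \<comment> \<open>Off the closed support the function agrees with 0 on an open neighbourhood, so
      it has the derivative of the zero function there.\<close>
    have "((\<lambda>x. 0) has_derivative (\<lambda>x. 0)) (at x)" by simp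
    then have "(\<phi> has_derivative (\<lambda>x. 0)) (at x)"
      by (rule has_derivative_transform_within_open[where s = "- closure {x. \<phi> x \<noteq> 0}"])
         (use x closure_subset[of "{x. \<phi> x \<noteq> 0}"] in auto)
    then show False using x by (simp add: partial_deriv_eq)
  qed
qed (use assms in \<open>auto simp: test_function_iff smooth_partial_deriv\<close>)

lemma test_function_continuous_on: "test_function S \<phi> \<Longrightarrow> continuous_on A \<phi>"
  by (simp add: test_function_iff smooth_continuous_on)

lemma test_function_outside: "test_function S \<phi> \<Longrightarrow> x \<notin> S \<Longrightarrow> \<phi> x = 0"
  using closure_subset[of "{x. \<phi> x \<noteq> 0}"] by (auto simp: test_function_iff)

lemma test_field_outside: "test_field S \<phi> \<Longrightarrow> x \<notin> S \<Longrightarrow> \<phi> x = 0"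
  using test_function_outside[of S "\<lambda>x. \<phi> x $ _"] by (simp add: test_field_def vec_eq_iff)

lemma test_field_partial_deriv:
  "test_field S \<phi> \<Longrightarrow> test_function S (partial_deriv i (\<lambda>x. \<phi> x $ j))"
  by (simp add: test_field_def test_function_partial_deriv)

lemma test_function_classical_div:
  assumes "test_field S \<phi>"
  shows "test_function S (classical_div \<phi>)"
proof -
  have "classical_div \<phi> = (\<lambda>x. partial_deriv 1 (\<lambda>y. \<phi> y $ 1) x + partial_deriv 2 (\<lambda>y. \<phi> y $ 2) x
      + partial_deriv 3 (\<lambda>y. \<phi> y $ 3) x)"
    by (rule ext) (simp only: classical_div_def sum_3)
  then show ?thesis
    by (simp only: test_function_add test_field_partial_deriv[OF assms])
qed

lemma test_field_classical_grad:
  "test_function S \<phi> \<Longrightarrow> test_field S (classical_grad \<phi>)"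
  by (simp add: test_field_def classical_grad_def test_function_partial_deriv)

lemma test_field_classical_curl:
  assumes "test_field S \<phi>"
  shows "test_field S (classical_curl \<phi>)"
proof -
  have "test_function S (\<lambda>x. partial_deriv i (\<lambda>y. \<phi> y $ j) x - partial_deriv k (\<lambda>y. \<phi> y $ l) x)"
    for i j k l
    by (intro test_function_diff test_field_partial_deriv[OF assms])
  then show ?thesis
    unfolding test_field_def classical_curl_def forall_3 vector_3 by blast
qed

lemma test_field_smooth: "test_field S \<phi> \<Longrightarrow> smooth (\<lambda>x. \<phi> x $ i)"
  by (simp add: test_field_def test_function_iff)

lemma classical_div_curl:
  assumes "test_field S \<phi>"
  shows "classical_div (classical_curl \<phi>) = (\<lambda>x. 0)"
proof
  fix x
  note sm = test_field_smooth[OF assms]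
  have d: "partial_deriv i (\<lambda>x. partial_deriv j (\<lambda>y. \<phi> y $ k) x - partial_deriv l (\<lambda>y. \<phi> y $ m) x) x =
      partial_deriv i (partial_deriv j (\<lambda>y. \<phi> y $ k)) x - partial_deriv i (partial_deriv l (\<lambda>y. \<phi> y $ m)) x"
    for i j k l m
    by (simp add: partial_deriv_diff smooth_differentiable smooth_partial_deriv sm)
  \<comment> \<open>Oriented so that the smaller index ends up outside. The rewriting terminates,
    and the six mixed derivatives then cancel in pairs.\<close>
  have c: "partial_deriv 2 (partial_deriv 1 (\<lambda>y. \<phi> y $ k)) x = partial_deriv 1 (partial_deriv 2 (\<lambda>y. \<phi> y $ k)) x"
    "partial_deriv 3 (partial_deriv 1 (\<lambda>y. \<phi> y $ k)) x = partial_deriv 1 (partial_deriv 3 (\<lambda>y. \<phi> y $ k)) x"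
    "partial_deriv 3 (partial_deriv 2 (\<lambda>y. \<phi> y $ k)) x = partial_deriv 2 (partial_deriv 3 (\<lambda>y. \<phi> y $ k)) x"
    for k
    by (rule fun_cong[OF partial_deriv_commute[OF sm]])+
  show "classical_div (classical_curl \<phi>) x = 0"
    unfolding classical_div_def classical_curl_def sum_3 vector_3 d c by simp
qed

lemma classical_curl_grad:
  assumes "test_function S \<phi>"
  shows "classical_curl (classical_grad \<phi>) = (\<lambda>x. 0)"
proof -
  have "smooth \<phi>" using assms by (simp add: test_function_iff)
  then show ?thesis
    using partial_deriv_commute[of \<phi> 2 3] partial_deriv_commute[of \<phi> 1 3] partial_deriv_commute[of \<phi> 1 2]
    unfolding classical_curl_def classical_grad_def fun_eq_iff vec_eq_iff forall_3 vector_3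
    by simp
qed

lemma test_function_square_integrable:
  assumes "test_function S \<phi>"
  shows "square_integrable \<phi>"
proof -
  let ?C = "closure {x. \<phi> x \<noteq> 0}"
  have m: "\<phi> \<in> borel_measurable lebesgue" using assms test_function_measurable by blast
  have "integrable lborel (\<lambda>x. indicator ?C x *\<^sub>R (norm (\<phi> x))\<^sup>2)"
    using assms by (intro borel_integrable_compact continuous_intros test_function_continuous_on)
      (auto simp: test_function_iff)
  moreover have "(\<lambda>x. indicator ?C x *\<^sub>R (norm (\<phi> x))\<^sup>2) = (\<lambda>x. (norm (\<phi> x))\<^sup>2)"
    using closure_subset[of "{x. \<phi> x \<noteq> 0}"] by (fastforce simp: indicator_def fun_eq_iff)
  ultimately have "integrable lborel (\<lambda>x. (norm (\<phi> x))\<^sup>2)" by simp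
  then have "integrable lebesgue (\<lambda>x. (norm (\<phi> x))\<^sup>2)"
    by (simp add: integrable_completion)
  with m show ?thesis by (simp add: square_integrable_def)
qed

lemma test_field_square_integrable:
  assumes "test_field S \<phi>"
  shows "square_integrable \<phi>"
proof -
  have "integrable lebesgue (\<lambda>x. \<Sum>i\<in>UNIV. (norm (\<phi> x $ i))\<^sup>2)"
    using assms test_function_square_integrable
    by (intro Bochner_Integration.integrable_sum) (auto simp: test_field_def square_integrable_def)
  then have "integrable lebesgue (\<lambda>x. (norm (\<phi> x))\<^sup>2)"
    by (simp add: norm_vec_def L2_set_def sum_nonneg)
  with test_field_measurable(1)[OF assms] show ?thesis by (simp add: square_integrable_def)
qed

section \<open>The fundamental lemma of the calculus of variations\<close>

text \<open>The family is closed under differentiation up to linear combinations, so that no separate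
  estimates are needed for the higher derivatives of \<open>exp (-1/t)\<close> at \<open>0\<close>.\<close>

definition flat_exp :: "nat \<Rightarrow> real \<Rightarrow> real" where
  "flat_exp n t = (if t > 0 then exp (- 1 / t) / t ^ n else 0)"

text \<open>From the right, the substitution s = 1/t turns this into the limit of s^n / exp s at
  infinity. All n are needed at once, because the difference quotient of one member at 0 is the next
  member.\<close>

lemma flat_exp_tendsto_0: "(flat_exp n \<longlongrightarrow> 0) (at 0)"
proof (rule filterlim_split_at)
  show "filterlim (flat_exp n) (nhds 0) (at_left 0)"
    by (rule tendsto_eventually) (auto simp: flat_exp_def eventually_at_filter)
  have "((\<lambda>t. inverse t ^ n / exp (inverse t)) \<longlongrightarrow> 0) (at_right (0::real))"
    by (rule filterlim_compose[OF tendsto_power_div_exp_0 filterlim_inverse_at_top_right])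
  moreover have "eventually (\<lambda>t. inverse t ^ n / exp (inverse t) = flat_exp n t) (at_right 0)"
    by (auto simp: flat_exp_def eventually_at_filter field_simps exp_minus power_inverse)
  ultimately show "filterlim (flat_exp n) (nhds 0) (at_right 0)"
    by (rule Lim_transform_eventually)
qed

lemma flat_exp_has_derivative:
  "(flat_exp n has_real_derivative flat_exp (n + 2) t - n * flat_exp (n + 1) t) (at t)"
proof (cases t "0::real" rule: linorder_cases)
  case less
  have "((\<lambda>t. 0) has_real_derivative 0) (at t)" by simp
  then have "(flat_exp n has_real_derivative 0) (at t)"
    by (rule has_field_derivative_transform_within_open[where S = "{..<0}"])
       (use less in \<open>auto simp: flat_exp_def\<close>)
  then show ?thesis using less by (simp add: flat_exp_def)
next
  case equal
  \<comment> \<open>The quotient is \<open>flat_exp (Suc n) h\<close> on both sides of 0, so the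
    derivative at 0 is a limit that is already known.\<close>
  have "((\<lambda>h. (flat_exp n (0 + h) - flat_exp n 0) / h) \<longlongrightarrow> 0) (at 0)"
  proof (rule Lim_transform_eventually)
    show "(flat_exp (Suc n) \<longlongrightarrow> 0) (at 0)" by (rule flat_exp_tendsto_0)
    show "\<forall>\<^sub>F h in at 0. flat_exp (Suc n) h = (flat_exp n (0 + h) - flat_exp n 0) / h"
      by (auto simp: flat_exp_def eventually_at_filter)
  qed
  then show ?thesis using equal by (simp add: DERIV_def flat_exp_def)
next
  case greater
  have "((\<lambda>t. exp (- 1 / t)) has_real_derivative exp (- 1 / t) / (t * t)) (at t)"
    using greater by (auto intro!: derivative_eq_intros)
  then have "((\<lambda>t. exp (- 1 / t) / t ^ n) has_real_derivative
      (exp (- 1 / t) / (t * t) * t ^ n - exp (- 1 / t) * (real n * t ^ (n - Suc 0))) / (t ^ n * t ^ n)) (at t)"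
    by (rule DERIV_divide) (use greater DERIV_pow[of n t] in auto)
  moreover have "(exp (- 1 / t) / (t * t) * t ^ n - exp (- 1 / t) * (real n * t ^ (n - Suc 0))) / (t ^ n * t ^ n)
      = flat_exp (n + 2) t - n * flat_exp (n + 1) t"
    using greater by (cases n) (simp_all add: flat_exp_def field_simps)
  ultimately have "((\<lambda>t. exp (- 1 / t) / t ^ n) has_real_derivative flat_exp (n + 2) t - n * flat_exp (n + 1) t) (at t)"
    by simp
  then show ?thesis
    by (rule has_field_derivative_transform_within_open[where S = "{0<..}"])
       (use greater in \<open>auto simp: flat_exp_def\<close>)
qed

text \<open>Serves as the invariant class for \<open>smooth_coinduct\<close>. The argument of
  \<open>coord\<close> is affine in one coordinate, so the chain rule produces only constant
  factors; sums and products absorb the rest of each derivative.\<close>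

inductive flat_combination :: "(real^3 \<Rightarrow> real) \<Rightarrow> bool" where
  const: "flat_combination (\<lambda>x. c)"
| coord: "flat_combination (\<lambda>x. flat_exp n (c * x $ j + d))"
| add: "flat_combination f \<Longrightarrow> flat_combination g \<Longrightarrow> flat_combination (\<lambda>x. f x + g x)"
| mult: "flat_combination f \<Longrightarrow> flat_combination g \<Longrightarrow> flat_combination (\<lambda>x. f x * g x)"

lemma flat_exp_coord_has_derivative:
  "((\<lambda>x. flat_exp n (c * x $ j + d)) has_derivative
     (\<lambda>h. (flat_exp (n + 2) (c * x $ j + d) - n * flat_exp (n + 1) (c * x $ j + d)) * (c * h $ j))) (at x)"
  for x :: "real^3"
proof -
  have "((\<lambda>x. c * x $ j + d) has_derivative (\<lambda>h. c * h $ j)) (at x)"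
    by (auto intro!: derivative_eq_intros bounded_linear_imp_has_derivative bounded_linear_vec_nth)
  moreover have "(flat_exp n has_derivative (*) (flat_exp (n + 2) t - n * flat_exp (n + 1) t)) (at t)" for t
    using flat_exp_has_derivative by (simp add: has_field_derivative_def)
  ultimately show ?thesis by (rule has_derivative_compose)
qed

lemma flat_combination_differentiable:
  "flat_combination f \<Longrightarrow> f differentiable (at x)"
proof (induction rule: flat_combination.induct)
  case (coord n c j d)
  show ?case using flat_exp_coord_has_derivative unfolding differentiable_def by blast
qed auto

lemma flat_combination_partial_deriv:
  "flat_combination f \<Longrightarrow> flat_combination (partial_deriv i f)"
proof (induction rule: flat_combination.induct)
  case (const c)
  show ?case by (simp add: flat_combination.const)
next
  case (coord n c j d)
  have "partial_deriv i (\<lambda>x. flat_exp n (c * x $ j + d)) =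
    (\<lambda>x. (flat_exp (n + 2) (c * x $ j + d) + (- real n) * flat_exp (n + 1) (c * x $ j + d)) * (c * axis i 1 $ j))"
    by (rule ext, subst partial_deriv_eq[OF flat_exp_coord_has_derivative]) simp
  moreover have "flat_combination \<dots>"
    by (intro flat_combination.intros)
  ultimately show ?case by simp
next
  case (add f g)
  then show ?case
    by (simp add: partial_deriv_add flat_combination_differentiable flat_combination.add)
next
  case (mult f g)
  then show ?case
    by (simp add: partial_deriv_mult flat_combination_differentiable flat_combination.intros)
qed

lemma flat_combination_smooth: "flat_combination f \<Longrightarrow> smooth f"
  by (rule smooth_coinduct[of flat_combination])
     (simp_all add: flat_combination_differentiable flat_combination_partial_deriv)

lemma flat_combination_prod:
  "finite A \<Longrightarrow> (\<And>i. i \<in> A \<Longrightarrow> flat_combination (f i)) \<Longrightarrow> flat_combination (\<lambda>x. \<Prod>i\<in>A. f i x)"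
  by (induction rule: finite_induct) (auto intro: flat_combination.intros)

text \<open>For t > 0 the factor \<open>flat_exp 0 (n * t)\<close> is exp (-1/(n t)), which tends to
  1 as n grows. The bumps therefore approximate the indicator of the open box, and they are
  supported in the closed box for every n.\<close>

definition box_bump :: "real^3 \<Rightarrow> real^3 \<Rightarrow> nat \<Rightarrow> real^3 \<Rightarrow> real" where
  "box_bump a b n x = (\<Prod>i\<in>UNIV. flat_exp 0 (n * (x $ i - a $ i)) * flat_exp 0 (n * (b $ i - x $ i)))"

lemma smooth_box_bump: "smooth (box_bump a b n)"
proof -
  \<comment> \<open>Each factor is first written with an affine argument, the shape required by the
    rule \<open>coord\<close>.\<close>
  have "flat_combination (\<lambda>x. flat_exp 0 (n * x $ i + - (n * a $ i)) * flat_exp 0 (- n * x $ i + n * b $ i))" for i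
    by (intro flat_combination.intros)
  then have "flat_combination (\<lambda>x. flat_exp 0 (n * (x $ i - a $ i)) * flat_exp 0 (n * (b $ i - x $ i)))" for i
    by (simp add: algebra_simps)
  then show ?thesis
    unfolding box_bump_def[abs_def] by (intro flat_combination_smooth flat_combination_prod) auto
qed

lemma flat_exp_bounds: "0 \<le> flat_exp 0 t" "flat_exp 0 t \<le> 1"
  by (auto simp: flat_exp_def)

lemma box_bump_bounds: "0 \<le> box_bump a b n x" "box_bump a b n x \<le> 1"
  unfolding box_bump_def
  by (auto intro!: prod_nonneg prod_le_1 mult_nonneg_nonneg mult_le_one simp: flat_exp_bounds)

lemma box_bump_outside: "x \<notin> box a b \<Longrightarrow> box_bump a b n x = 0"
proof -
  assume "x \<notin> box a b"
  then obtain i where "x $ i \<le> a $ i \<or> b $ i \<le> x $ i"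
    by (auto simp: mem_box_cart not_less)
  then have "flat_exp 0 (n * (x $ i - a $ i)) * flat_exp 0 (n * (b $ i - x $ i)) = 0"
    by (auto simp: flat_exp_def zero_less_mult_iff)
  then show ?thesis
    unfolding box_bump_def by (intro prod_zero) auto
qed

lemma flat_exp_scaled_tendsto_1: "t > 0 \<Longrightarrow> (\<lambda>n. flat_exp 0 (real n * t)) \<longlonglongrightarrow> 1"
proof (rule Lim_transform_eventually)
  assume t: "t > 0"
  have "(\<lambda>n. exp (- ((1 / t) * (1 / real n)))) \<longlonglongrightarrow> exp (- ((1 / t) * 0))"
    by (intro tendsto_intros lim_1_over_n)
  then show "(\<lambda>n. exp (- ((1 / t) * (1 / real n)))) \<longlonglongrightarrow> 1" by simp
  \<comment> \<open>Only eventually: at n = 0 the left side is exp 0 = 1, since 1/0 = 0, while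
    \<open>flat_exp 0 0\<close> is 0.\<close>
  show "\<forall>\<^sub>F n in sequentially. exp (- ((1 / t) * (1 / real n))) = flat_exp 0 (real n * t)"
    using eventually_gt_at_top[of "0::nat"] by eventually_elim (use t in \<open>simp add: flat_exp_def mult.commute\<close>)
qed

lemma box_bump_tendsto: "(\<lambda>n. box_bump a b n x) \<longlonglongrightarrow> indicator (box a b) x"
proof (cases "x \<in> box a b")
  case True
  have "(\<lambda>n. box_bump a b n x) \<longlonglongrightarrow> (\<Prod>i\<in>(UNIV::3 set). 1 * 1)"
    unfolding box_bump_def using True
    by (intro tendsto_prod tendsto_mult flat_exp_scaled_tendsto_1) (auto simp: mem_box_cart)
  with True show ?thesis by simp
qed (simp add: box_bump_outside)

lemma test_function_box_bump: "cbox a b \<subseteq> S \<Longrightarrow> test_function S (box_bump a b n)"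
  by (rule test_function_subset_support[of _ "cbox a b"])
     (use box_bump_outside[of _ a b n] box_subset_cbox[of a b] in \<open>auto simp: smooth_box_bump\<close>)

text \<open>A bounded box has finite measure, so its indicator is itself square integrable and the
  product with f is integrable. The function f alone may fail to be integrable over the whole
  space.\<close>

lemma square_integrable_indicator_integrable:
  fixes f :: "real^3 \<Rightarrow> real"
  assumes "square_integrable f"
  shows "integrable lebesgue (\<lambda>x. indicator (box a b) x * f x)"
proof -
  have "integrable lebesgue (indicator (box a b) :: real^3 \<Rightarrow> real)"
    by (rule integrable_real_indicator) (use emeasure_bounded_finite[OF bounded_box] in auto)
  moreover have "(\<lambda>x. (norm (indicator (box a b) x :: real))\<^sup>2) = indicator (box a b)"
    by (auto simp: indicator_def)
  ultimately have "square_integrable (indicator (box a b) :: real^3 \<Rightarrow> real)"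
    unfolding square_integrable_def by simp
  from square_integrable_inner[OF this assms] show ?thesis by simp
qed

text \<open>The bumps are test functions converging to the indicator of the box. They lie between 0
  and that indicator, so f restricted to the box dominates and the vanishing integrals pass to the
  limit.\<close>

lemma integral_box_eq_0:
  fixes f :: "real^3 \<Rightarrow> real"
  assumes f: "square_integrable f"
    and zero: "\<And>\<phi>. test_function S \<phi> \<Longrightarrow> (\<integral>x. f x * \<phi> x \<partial>lebesgue) = 0"
    and "cbox a b \<subseteq> S"
  shows "(\<integral>x. indicator (box a b) x * f x \<partial>lebesgue) = 0"
proof -
  have [measurable]: "f \<in> borel_measurable lebesgue" using f by (simp add: square_integrable_def)
  have [measurable]: "box_bump a b n \<in> borel_measurable lebesgue" for n
    using test_function_measurable(1)[OF test_function_box_bump[OF assms(3)]] .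
  have "(\<lambda>n. \<integral>x. box_bump a b n x * f x \<partial>lebesgue) \<longlonglongrightarrow> (\<integral>x. indicator (box a b) x * f x \<partial>lebesgue)"
  proof (rule integral_dominated_convergence[where w = "\<lambda>x. norm (indicator (box a b) x * f x)"])
    show "integrable lebesgue (\<lambda>x. norm (indicator (box a b) x * f x))"
      by (intro integrable_norm square_integrable_indicator_integrable f)
    show "AE x in lebesgue. (\<lambda>n. box_bump a b n x * f x) \<longlonglongrightarrow> indicator (box a b) x * f x"
      by (intro AE_I2 tendsto_mult box_bump_tendsto tendsto_const)
    show "AE x in lebesgue. norm (box_bump a b n x * f x) \<le> norm (indicator (box a b) x * f x)" for n
    proof (rule AE_I2)
      fix x
      show "norm (box_bump a b n x * f x) \<le> norm (indicator (box a b) x * f x)"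
        using box_bump_bounds[of a b n x] box_bump_outside[of x a b n]
        by (cases "x \<in> box a b") (auto simp: abs_mult intro: mult_left_le_one_le)
    qed
    show "(\<lambda>x. indicator (box a b) x * f x) \<in> borel_measurable lebesgue"
      using square_integrable_indicator_integrable[OF f] by (rule borel_measurable_integrable)
    show "(\<lambda>x. box_bump a b n x * f x) \<in> borel_measurable lebesgue" for n
      by (rule borel_measurable_times) measurable
  qed
  moreover have "(\<integral>x. box_bump a b n x * f x \<partial>lebesgue) = 0" for n
    using zero[OF test_function_box_bump[OF assms(3)]] by (simp add: mult.commute)
  ultimately show ?thesis by (simp add: LIMSEQ_const_iff)
qed

text \<open>Open boxes are stable under intersection and generate the Borel sets, so by Dynkin's
  argument the integral vanishes over every Borel set. An integrable function with this property is
  zero almost everywhere.\<close>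

lemma AE_eq_0_if_box_integrals_eq_0:
  fixes g :: "real^3 \<Rightarrow> real"
  assumes g: "integrable lebesgue g"
    and box: "\<And>a b. (\<integral>x. indicator (box a b) x * g x \<partial>lebesgue) = 0"
    and total: "(\<integral>x. g x \<partial>lebesgue) = 0"
  shows "AE x in lebesgue. g x = 0"
proof -
  \<comment> \<open>The induction runs over Borel sets, so g is replaced by a Borel function that
    agrees with it almost everywhere.\<close>
  obtain g' where g': "g' \<in> borel_measurable lborel" and ae: "AE x in lborel. g x = g' x"
    using completion_ex_borel_measurable_real[OF borel_measurable_integrable[OF g]] by blast
  have aeL: "AE x in lebesgue. g x = g' x" using ae by (rule AE_completion)
  have meas[measurable]: "g \<in> borel_measurable lebesgue" "g' \<in> borel_measurable lebesgue"
    using g measurable_completion[OF g'] by simp_all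
  have "integrable lebesgue g'"
    by (rule integrable_cong_AE_imp[OF g]) (use aeL in auto)
  then have int: "integrable lborel g'"
    using g' by (simp add: integrable_completion)
  have eq: "(\<integral>x. indicator A x *\<^sub>R g' x \<partial>lborel) = (\<integral>x. indicator A x * g x \<partial>lebesgue)"
    if A[measurable]: "A \<in> sets borel" for A
  proof -
    have [measurable]: "A \<in> sets lebesgue" using A by simp
    have "(\<integral>x. indicator A x *\<^sub>R g' x \<partial>lborel) = (\<integral>x. indicator A x *\<^sub>R g' x \<partial>lebesgue)"
      using g' by (intro integral_completion[symmetric]) simp
    also have "\<dots> = (\<integral>x. indicator A x * g x \<partial>lebesgue)"
      by (intro integral_cong_AE) (use aeL in auto)
    finally show ?thesis .
  qed
  have all: "(\<integral>x. g' x \<partial>lborel) = 0"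
    using eq[of UNIV] total by simp
  have "set_lebesgue_integral lborel A g' = 0" if "A \<in> sets lborel" for A
  proof -
    let ?G = "range (\<lambda>(a, b). box a b :: (real^3) set)"
    have "A \<in> sigma_sets UNIV ?G" using that by (simp add: borel_eq_box)
    show ?thesis
    proof (rule sigma_sets_induct_disjoint[OF _ _ \<open>A \<in> sigma_sets UNIV ?G\<close>])
      show "Int_stable ?G" by (auto simp: Int_stable_def box_Int_box)
      show "?G \<subseteq> Pow UNIV" by simp
      show "set_lebesgue_integral lborel {} g' = 0" by (simp add: set_lebesgue_integral_def)
    next
      fix A assume "A \<in> ?G"
      then show "set_lebesgue_integral lborel A g' = 0"
        using eq box by (auto simp: set_lebesgue_integral_def)
    next
      fix A assume sig: "A \<in> sigma_sets UNIV ?G" and 0: "set_lebesgue_integral lborel A g' = 0"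
      have A: "A \<in> sets lborel" using sig by (simp add: borel_eq_box)
      \<comment> \<open>The whole space is not a box, so complements rely on the separate hypothesis
        \<open>total\<close>, here in the form \<open>all\<close>.\<close>
      have "set_lebesgue_integral lborel (UNIV - A) g' = (\<integral>x. g' x - indicator A x *\<^sub>R g' x \<partial>lborel)"
        unfolding set_lebesgue_integral_def by (intro Bochner_Integration.integral_cong) (auto simp: indicator_def)
      also have "\<dots> = (\<integral>x. g' x \<partial>lborel) - (\<integral>x. indicator A x *\<^sub>R g' x \<partial>lborel)"
        by (intro Bochner_Integration.integral_diff integrable_mult_indicator int A)
      finally show "set_lebesgue_integral lborel (UNIV - A) g' = 0"
        using 0 all by (simp add: set_lebesgue_integral_def)
    next
      fix A :: "nat \<Rightarrow> (real^3) set"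
      assume disj: "disjoint_family A" and sig: "range A \<subseteq> sigma_sets UNIV ?G"
        and 0: "\<And>i. set_lebesgue_integral lborel (A i) g' = 0"
      have A: "A i \<in> sets lborel" for i using sig by (auto simp: borel_eq_box)
      have "set_integrable lborel (\<Union>i. A i) g'"
        unfolding set_integrable_def by (intro integrable_mult_indicator int sets.countable_UN A) (use A in auto)
      then have "set_lebesgue_integral lborel (\<Union>i. A i) g' = (\<Sum>i. set_lebesgue_integral lborel (A i) g')"
        using A disj by (intro lebesgue_integral_countable_add) (auto simp: disjoint_family_on_def)
      with 0 show "set_lebesgue_integral lborel (\<Union>i. A i) g' = 0" by simp
    qed
  qed
  with int have "AE x in lborel. g' x = 0" by (rule sigma_finite_measure.density_zero[OF sigma_finite_lborel])
  then have "AE x in lebesgue. g' x = 0" by (rule AE_completion)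
  with aeL show ?thesis by eventually_elim simp
qed

text \<open>The claim is localized to closed boxes inside S, where f is integrable and integrals
  over boxes are limits of integrals against test functions. Countably many such boxes cover the
  open set S.\<close>

theorem fundamental_lemma_calculus_of_variations:
  fixes f :: "real^3 \<Rightarrow> real"
  assumes "open S" and f: "square_integrable f"
    and zero: "\<And>\<phi>. test_function S \<phi> \<Longrightarrow> (\<integral>x. f x * \<phi> x \<partial>lebesgue) = 0"
  shows "AE x in lebesgue. x \<in> S \<longrightarrow> f x = 0"
proof -
  have cb: "AE x in lebesgue. x \<in> cbox a b \<longrightarrow> f x = 0" if ab: "cbox a b \<subseteq> S" for a b
  proof -
    have "AE x in lebesgue. indicator (box a b) x * f x = 0"
    proof (rule AE_eq_0_if_box_integrals_eq_0)
      show "integrable lebesgue (\<lambda>x. indicator (box a b) x * f x)"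
        by (rule square_integrable_indicator_integrable[OF f])
      show "(\<integral>x. indicator (box a b) x * f x \<partial>lebesgue) = 0"
        by (rule integral_box_eq_0[OF f zero ab])
      fix c d
      \<comment> \<open>The same corners describe the intersection of the open and of the closed
        boxes, so the closed intersection stays in S and \<open>integral_box_eq_0\<close> applies to
        it.\<close>
      obtain a' b' where ab': "box c d \<inter> box a b = box a' b'" "cbox c d \<inter> cbox a b = cbox a' b'"
        by (rule that) (rule box_Int_box, rule Int_interval)
      have "cbox a' b' \<subseteq> S" using ab ab' by blast
      then have "(\<integral>x. indicator (box a' b') x * f x \<partial>lebesgue) = 0"
        by (intro integral_box_eq_0[OF f zero])
      then show "(\<integral>x. indicator (box c d) x * (indicator (box a b) x * f x) \<partial>lebesgue) = 0"
        by (simp add: ab'[symmetric] indicator_inter_arith mult.assoc)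
    qed
    \<comment> \<open>The argument so far concerns open boxes, the covering of S uses closed ones;
      the difference is a null set.\<close>
    moreover have "AE x in lebesgue. x \<notin> cbox a b - box a b"
      using negligible_frontier_interval[of a b]
      by (intro AE_not_in) (simp add: negligible_iff_null_sets)
    ultimately show ?thesis by eventually_elim auto
  qed
  obtain \<D> where D: "countable \<D>" "\<D> \<subseteq> Pow S" "\<And>X. X \<in> \<D> \<Longrightarrow> \<exists>a b. X = cbox a b" "\<Union>\<D> = S"
    using open_countable_Union_open_cbox[OF \<open>open S\<close>] by metis
  have "AE x in lebesgue. \<forall>X\<in>\<D>. x \<in> X \<longrightarrow> f x = 0"
    using D(1)
  proof (rule AE_ball_countable[THEN iffD2], intro ballI)
    fix X assume "X \<in> \<D>"
    then obtain a b where "X = cbox a b" "X \<subseteq> S" using D by blast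
    then show "AE x in lebesgue. x \<in> X \<longrightarrow> f x = 0" using cb by simp
  qed
  then show ?thesis by eventually_elim (use D(4) in blast)
qed

section \<open>Weak derivatives and broken spaces\<close>

lemma L2_rel_refl: "L2_rel f f \<longleftrightarrow> square_integrable f"
  by (simp add: L2_rel_def)

lemma L2_cases:
  fixes u :: "'b::euclidean_space L2"
  obtains f where "square_integrable f" "u = abs_L2 f"
  by (metis L2_rel_refl Quotient3_L2 Quotient3_def)

lemma abs_L2_eq_iff:
  "square_integrable f \<Longrightarrow> square_integrable g \<Longrightarrow> abs_L2 f = abs_L2 g \<longleftrightarrow> (AE x in lebesgue. f x = g x)"
  using Quotient3_rel[OF Quotient3_L2, of f g] by (auto simp: L2_rel_def)

lemma inner_abs_L2:
  "square_integrable f \<Longrightarrow> square_integrable g \<Longrightarrow> abs_L2 f \<bullet> abs_L2 g = (\<integral>x. f x \<bullet> g x \<partial>lebesgue)"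
  by (simp add: inner_L2.abs_eq L2_rel_refl)

lemma abs_L2_zero: "abs_L2 (\<lambda>x. 0) = 0"
  by (simp add: zero_L2_def)

lemma mem_L2_on_abs: "square_integrable f \<Longrightarrow> abs_L2 f \<in> L2_on S \<longleftrightarrow> (AE x in lebesgue. x \<notin> S \<longrightarrow> f x = 0)"
  by (simp add: L2_on_def supported_on.abs_eq L2_rel_refl)

text \<open>Test fields and their classical derivatives are square integrable, so the defining
  integrals are inner products of classes. From here on weak derivatives are handled by bilinearity,
  without representatives; the same holds for the two analogues below.\<close>

lemma has_weak_grad_iff:
  "has_weak_grad S u g \<longleftrightarrow>
    (\<forall>\<phi>. test_field S \<phi> \<longrightarrow> u \<bullet> abs_L2 (classical_div \<phi>) = - (g \<bullet> abs_L2 \<phi>))"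
proof -
  obtain f where f: "square_integrable f" "u = abs_L2 f" by (rule L2_cases)
  obtain h where h: "square_integrable h" "g = abs_L2 h" by (rule L2_cases)
  show ?thesis
    by (simp add: f h has_weak_grad.abs_eq L2_rel_refl inner_abs_L2 test_field_square_integrable
        test_function_square_integrable[OF test_function_classical_div] cong: imp_cong)
qed

lemma has_weak_curl_iff:
  "has_weak_curl S u c \<longleftrightarrow>
    (\<forall>\<phi>. test_field S \<phi> \<longrightarrow> u \<bullet> abs_L2 (classical_curl \<phi>) = c \<bullet> abs_L2 \<phi>)"
proof -
  obtain f where f: "square_integrable f" "u = abs_L2 f" by (rule L2_cases)
  obtain h where h: "square_integrable h" "c = abs_L2 h" by (rule L2_cases)
  show ?thesis
    by (simp add: f h has_weak_curl.abs_eq L2_rel_refl inner_abs_L2 test_field_square_integrable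
        test_field_square_integrable[OF test_field_classical_curl] cong: imp_cong)
qed

lemma has_weak_div_iff:
  "has_weak_div S u d \<longleftrightarrow>
    (\<forall>\<phi>. test_function S \<phi> \<longrightarrow> u \<bullet> abs_L2 (classical_grad \<phi>) = - (d \<bullet> abs_L2 \<phi>))"
proof -
  obtain f where f: "square_integrable f" "u = abs_L2 f" by (rule L2_cases)
  obtain h where h: "square_integrable h" "d = abs_L2 h" by (rule L2_cases)
  show ?thesis
    by (simp add: f h has_weak_div.abs_eq L2_rel_refl inner_abs_L2 test_function_square_integrable
        test_field_square_integrable[OF test_field_classical_grad] del: inner_real_def cong: imp_cong)
qed

lemma square_integrable_component:
  assumes "square_integrable (f :: real^3 \<Rightarrow> real^3)"
  shows "square_integrable (\<lambda>x. f x $ i)"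
proof -
  have [measurable]: "f \<in> borel_measurable lebesgue" using assms by (simp add: square_integrable_def)
  have m: "(\<lambda>x. f x $ i) \<in> borel_measurable lebesgue"
    by (rule measurable_compose[OF _ borel_measurable_continuous_onI[of "\<lambda>y::real^3. y $ i"]])
      (auto intro!: continuous_intros)
  have "integrable lebesgue (\<lambda>x. (norm (f x $ i))\<^sup>2)"
    by (rule Bochner_Integration.integrable_bound[of _ "\<lambda>x. (norm (f x))\<^sup>2"])
       (use assms m in \<open>auto simp: square_integrable_def power2_le_iff_abs_le component_le_norm_cart
          intro!: AE_I2 abs_le_square_iff[THEN iffD1]\<close>)
  with m show ?thesis by (simp add: square_integrable_def)
qed

text \<open>Inside S the fundamental lemma applies to each component; outside S the class vanishes
  by membership in \<open>L2_on S\<close>. This makes the descriptions behind \<open>grad\<close>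
  and \<open>curl\<close> proper.\<close>

lemma L2_on_eq_0_if_orthogonal_test_fields:
  assumes "open S" "u \<in> L2_on S" and zero: "\<And>\<phi>. test_field S \<phi> \<Longrightarrow> u \<bullet> abs_L2 \<phi> = 0"
  shows "u = 0"
proof -
  obtain f where f: "square_integrable f" "u = abs_L2 f" by (rule L2_cases)
  have "AE x in lebesgue. x \<in> S \<longrightarrow> f x $ i = 0" for i
  proof (rule fundamental_lemma_calculus_of_variations[OF \<open>open S\<close> square_integrable_component[OF f(1)]])
    fix \<phi> assume \<phi>: "test_function S \<phi>"
    have z: "test_function S (\<lambda>x. 0)"
      by (rule test_function_subset_support[of _ "{}"]) (auto simp: smooth_const)
    \<comment> \<open>Putting the scalar test function into slot i isolates component i of
      f.\<close>
    have tf: "test_field S (\<lambda>x. axis i (\<phi> x))"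
      unfolding test_field_def
    proof
      fix j show "test_function S (\<lambda>x. axis i (\<phi> x) $ j)"
        using \<phi> z by (cases "j = i") (simp_all add: axis_def)
    qed
    have "u \<bullet> abs_L2 (\<lambda>x. axis i (\<phi> x)) = (\<integral>x. f x \<bullet> axis i (\<phi> x) \<partial>lebesgue)"
      unfolding f(2) by (rule inner_abs_L2[OF f(1) test_field_square_integrable[OF tf]])
    then show "(\<integral>x. f x $ i * \<phi> x \<partial>lebesgue) = 0"
      using zero[OF tf] by (simp add: inner_axis)
  qed
  then have "AE x in lebesgue. \<forall>i. x \<in> S \<longrightarrow> f x $ i = 0"
    unfolding AE_all_countable by blast
  moreover have "AE x in lebesgue. x \<notin> S \<longrightarrow> f x = 0"
    using assms(2) f by (simp add: mem_L2_on_abs)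
  ultimately have "AE x in lebesgue. f x = 0"
    by eventually_elim (auto simp: vec_eq_iff)
  then show ?thesis
    unfolding f(2) abs_L2_zero[symmetric] abs_L2_eq_iff[OF f(1) square_integrable_zero] .
qed

section \<open>Uniqueness and linearity of the weak gradient and curl\<close>

lemma subspace_L2_on: "subspace (L2_on S)"
proof -
  have z: "(0 :: 'b::euclidean_space L2) \<in> L2_on S"
    using mem_L2_on_abs[OF square_integrable_zero, of S] by (simp add: abs_L2_zero)
  have a: "u + v \<in> L2_on S" if uv: "u \<in> L2_on S" "v \<in> L2_on S" for u v :: "'b::euclidean_space L2"
  proof -
    obtain f where f: "square_integrable f" "u = abs_L2 f" by (rule L2_cases)
    obtain g where g: "square_integrable g" "v = abs_L2 g" by (rule L2_cases)
    have "AE x in lebesgue. x \<notin> S \<longrightarrow> f x = 0" "AE x in lebesgue. x \<notin> S \<longrightarrow> g x = 0"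
      using uv f g by (auto simp: mem_L2_on_abs)
    then have "AE x in lebesgue. x \<notin> S \<longrightarrow> f x + g x = 0"
      by eventually_elim simp
    then show ?thesis
      using f g by (simp add: plus_L2.abs_eq L2_rel_refl mem_L2_on_abs square_integrable_add)
  qed
  have s: "c *\<^sub>R u \<in> L2_on S" if u: "u \<in> L2_on S" for c and u :: "'b::euclidean_space L2"
  proof -
    obtain f where f: "square_integrable f" "u = abs_L2 f" by (rule L2_cases)
    have "AE x in lebesgue. x \<notin> S \<longrightarrow> f x = 0" using u f by (simp add: mem_L2_on_abs)
    then have "AE x in lebesgue. x \<notin> S \<longrightarrow> c *\<^sub>R f x = 0"
      by eventually_elim simp
    then show ?thesis
      using f mem_L2_on_abs[OF square_integrable_scaleR[of f c]]
      by (simp add: scaleR_L2.abs_eq L2_rel_refl)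
  qed
  show ?thesis by (simp add: subspace_def z a s)
qed

lemma weak_grad_unique:
  assumes "open S" "g \<in> L2_on S" "g' \<in> L2_on S" "has_weak_grad S u g" "has_weak_grad S u g'"
  shows "g = g'"
proof -
  have "g - g' = 0"
    using assms by (intro L2_on_eq_0_if_orthogonal_test_fields[of S] subspace_diff[OF subspace_L2_on])
      (auto simp: has_weak_grad_iff inner_diff_left)
  then show ?thesis by simp
qed

lemma weak_curl_unique:
  assumes "open S" "c \<in> L2_on S" "c' \<in> L2_on S" "has_weak_curl S u c" "has_weak_curl S u c'"
  shows "c = c'"
proof -
  have "c - c' = 0"
    using assms by (intro L2_on_eq_0_if_orthogonal_test_fields[of S] subspace_diff[OF subspace_L2_on])
      (auto simp: has_weak_curl_iff inner_diff_left)
  then show ?thesis by simp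
qed

lemma grad_eq: "open S \<Longrightarrow> g \<in> L2_on S \<Longrightarrow> has_weak_grad S u g \<Longrightarrow> grad S u = g"
  unfolding grad_def using weak_grad_unique by blast

lemma curl_eq: "open S \<Longrightarrow> c \<in> L2_on S \<Longrightarrow> has_weak_curl S u c \<Longrightarrow> curl S u = c"
  unfolding curl_def using weak_curl_unique by blast

lemma H1_grad:
  assumes "open S" "u \<in> H1 S"
  shows "grad S u \<in> L2_on S" "has_weak_grad S u (grad S u)"
proof -
  obtain w where "w \<in> L2_on S" "has_weak_grad S u w" using assms(2) unfolding H1_def by blast
  with grad_eq[OF assms(1) this] show "grad S u \<in> L2_on S" "has_weak_grad S u (grad S u)" by simp_all
qed

lemma Hcurl_curl:
  assumes "open S" "u \<in> Hcurl S"
  shows "curl S u \<in> L2_on S" "has_weak_curl S u (curl S u)"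
proof -
  obtain w where "w \<in> L2_on S" "has_weak_curl S u w" using assms(2) unfolding Hcurl_def by blast
  with curl_eq[OF assms(1) this] show "curl S u \<in> L2_on S" "has_weak_curl S u (curl S u)" by simp_all
qed

lemma H1_add:
  assumes "open S" "u \<in> H1 S" "v \<in> H1 S"
  shows "u + v \<in> H1 S" "grad S (u + v) = grad S u + grad S v"
proof -
  have "has_weak_grad S (u + v) (grad S u + grad S v)"
    using H1_grad(2)[OF assms(1)] assms by (simp add: has_weak_grad_iff inner_add_left)
  moreover have "grad S u + grad S v \<in> L2_on S"
    using H1_grad(1)[OF assms(1)] assms by (intro subspace_add[OF subspace_L2_on])
  moreover have "u + v \<in> L2_on S"
    using assms by (intro subspace_add[OF subspace_L2_on]) (auto simp: H1_def)
  ultimately show "u + v \<in> H1 S" "grad S (u + v) = grad S u + grad S v"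
    by (auto simp: H1_def intro: grad_eq[OF assms(1)])
qed

lemma H1_scaleR:
  assumes "open S" "u \<in> H1 S"
  shows "c *\<^sub>R u \<in> H1 S" "grad S (c *\<^sub>R u) = c *\<^sub>R grad S u"
proof -
  have "has_weak_grad S (c *\<^sub>R u) (c *\<^sub>R grad S u)"
    using H1_grad(2)[OF assms] by (simp add: has_weak_grad_iff)
  moreover have "c *\<^sub>R grad S u \<in> L2_on S"
    using H1_grad(1)[OF assms] by (intro subspace_scale[OF subspace_L2_on])
  moreover have "c *\<^sub>R u \<in> L2_on S"
    using assms by (intro subspace_scale[OF subspace_L2_on]) (auto simp: H1_def)
  ultimately show "c *\<^sub>R u \<in> H1 S" "grad S (c *\<^sub>R u) = c *\<^sub>R grad S u"
    by (auto simp: H1_def intro: grad_eq[OF assms(1)])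
qed

lemma Hcurl_add:
  assumes "open S" "u \<in> Hcurl S" "v \<in> Hcurl S"
  shows "u + v \<in> Hcurl S" "curl S (u + v) = curl S u + curl S v"
proof -
  have "has_weak_curl S (u + v) (curl S u + curl S v)"
    using Hcurl_curl(2)[OF assms(1)] assms by (simp add: has_weak_curl_iff inner_add_left)
  moreover have "curl S u + curl S v \<in> L2_on S"
    using Hcurl_curl(1)[OF assms(1)] assms by (intro subspace_add[OF subspace_L2_on])
  moreover have "u + v \<in> L2_on S"
    using assms by (intro subspace_add[OF subspace_L2_on]) (auto simp: Hcurl_def)
  ultimately show "u + v \<in> Hcurl S" "curl S (u + v) = curl S u + curl S v"
    by (auto simp: Hcurl_def intro: curl_eq[OF assms(1)])
qed

lemma Hcurl_scaleR:
  assumes "open S" "u \<in> Hcurl S"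
  shows "c *\<^sub>R u \<in> Hcurl S" "curl S (c *\<^sub>R u) = c *\<^sub>R curl S u"
proof -
  have "has_weak_curl S (c *\<^sub>R u) (c *\<^sub>R curl S u)"
    using Hcurl_curl(2)[OF assms] by (simp add: has_weak_curl_iff)
  moreover have "c *\<^sub>R curl S u \<in> L2_on S"
    using Hcurl_curl(1)[OF assms] by (intro subspace_scale[OF subspace_L2_on])
  moreover have "c *\<^sub>R u \<in> L2_on S"
    using assms by (intro subspace_scale[OF subspace_L2_on]) (auto simp: Hcurl_def)
  ultimately show "c *\<^sub>R u \<in> Hcurl S" "curl S (c *\<^sub>R u) = c *\<^sub>R curl S u"
    by (auto simp: Hcurl_def intro: curl_eq[OF assms(1)])
qed

lemma subspace_H1: "open S \<Longrightarrow> subspace (H1 S)"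
proof -
  assume "open S"
  have "0 \<in> H1 S"
    unfolding H1_def by (auto simp: has_weak_grad_iff subspace_0 subspace_L2_on intro!: bexI[of _ 0])
  with \<open>open S\<close> show ?thesis by (simp add: subspace_def H1_add H1_scaleR)
qed

lemma subspace_Hcurl: "open S \<Longrightarrow> subspace (Hcurl S)"
proof -
  assume "open S"
  have "0 \<in> Hcurl S"
    unfolding Hcurl_def by (auto simp: has_weak_curl_iff subspace_0 subspace_L2_on intro!: bexI[of _ 0])
  with \<open>open S\<close> show ?thesis by (simp add: subspace_def Hcurl_add Hcurl_scaleR)
qed

text \<open>Tested with \<phi>, the curl of the gradient is minus the product of u with div curl
  \<phi>, which is zero. So 0 is a weak curl, and by uniqueness it is the curl.\<close>

lemma curl_grad:
  assumes "open S" "u \<in> H1 S"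
  shows "grad S u \<in> Hcurl S" "curl S (grad S u) = 0"
proof -
  have "has_weak_curl S (grad S u) 0"
    unfolding has_weak_curl_iff
  proof (intro allI impI)
    fix \<phi> assume \<phi>: "test_field S \<phi>"
    have "grad S u \<bullet> abs_L2 (classical_curl \<phi>) = - (u \<bullet> abs_L2 (classical_div (classical_curl \<phi>)))"
      using H1_grad(2)[OF assms] test_field_classical_curl[OF \<phi>] by (simp add: has_weak_grad_iff)
    then show "grad S u \<bullet> abs_L2 (classical_curl \<phi>) = 0 \<bullet> abs_L2 \<phi>"
      by (simp add: classical_div_curl[OF \<phi>] abs_L2_zero)
  qed
  moreover have "(0 :: (real^3) L2) \<in> L2_on S" by (rule subspace_0[OF subspace_L2_on])
  ultimately show "grad S u \<in> Hcurl S" "curl S (grad S u) = 0"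
    using H1_grad(1)[OF assms] by (auto simp: Hcurl_def intro: curl_eq[OF assms(1)])
qed

text \<open>The same transfer to the test function, now with curl grad = 0, shows that 0 is a weak
  divergence. This is the global half of the conformity of discrete curls.\<close>

lemma curl_in_Hdiv:
  assumes "open S" "u \<in> Hcurl S"
  shows "curl S u \<in> Hdiv S"
proof -
  have "has_weak_div S (curl S u) 0"
    unfolding has_weak_div_iff
  proof (intro allI impI)
    fix \<phi> assume \<phi>: "test_function S \<phi>"
    have "curl S u \<bullet> abs_L2 (classical_grad \<phi>) = u \<bullet> abs_L2 (classical_curl (classical_grad \<phi>))"
      using Hcurl_curl(2)[OF assms] test_field_classical_grad[OF \<phi>] by (simp add: has_weak_curl_iff)
    then show "curl S u \<bullet> abs_L2 (classical_grad \<phi>) = - (0 \<bullet> abs_L2 \<phi>)"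
      by (simp add: classical_curl_grad[OF \<phi>] abs_L2_zero)
  qed
  moreover have "(0 :: real L2) \<in> L2_on S" by (rule subspace_0[OF subspace_L2_on])
  ultimately show ?thesis
    using Hcurl_curl(1)[OF assms] by (auto simp: Hdiv_def)
qed

section \<open>Restriction to subdomains\<close>

lemma square_integrable_restrict:
  assumes "square_integrable f" "S \<in> sets lebesgue"
  shows "square_integrable (\<lambda>x. if x \<in> S then f x else 0)"
proof -
  have [measurable]: "f \<in> borel_measurable lebesgue" "S \<in> sets lebesgue"
    using assms by (auto simp: square_integrable_def)
  have "integrable lebesgue (\<lambda>x. (norm (if x \<in> S then f x else 0))\<^sup>2)"
    by (rule Bochner_Integration.integrable_bound[of _ "\<lambda>x. (norm (f x))\<^sup>2"])
       (use assms in \<open>auto simp: square_integrable_def\<close>)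
  then show ?thesis by (simp add: square_integrable_def)
qed

lemma restr_abs_L2:
  "square_integrable f \<Longrightarrow> S \<in> sets lebesgue \<Longrightarrow> restr S (abs_L2 f) = abs_L2 (\<lambda>x. if x \<in> S then f x else 0)"
  by (simp add: restr.abs_eq L2_rel_refl)

lemma restr_in_L2_on: "S \<in> sets lebesgue \<Longrightarrow> restr S u \<in> L2_on S"
  by (cases u rule: L2_cases) (simp add: restr_abs_L2 mem_L2_on_abs square_integrable_restrict)

text \<open>Against a function that vanishes off S the restriction is invisible. It will be applied
  to test functions of a subdomain.\<close>

lemma inner_restr:
  assumes "S \<in> sets lebesgue" "square_integrable h" "\<And>x. x \<notin> S \<Longrightarrow> h x = 0"
  shows "restr S u \<bullet> abs_L2 h = u \<bullet> abs_L2 h"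
proof (cases u rule: L2_cases)
  case (1 f)
  have "(if x \<in> S then f x else 0) \<bullet> h x = f x \<bullet> h x" for x using assms(3) by simp
  with 1 assms show ?thesis
    by (simp add: restr_abs_L2 inner_abs_L2 square_integrable_restrict)
qed

text \<open>The default value 0 of \<open>restr\<close> is what keeps it linear for every set S,
  measurable or not.\<close>

lemma restr_non_measurable: "S \<notin> sets lebesgue \<Longrightarrow> restr S u = 0"
  by (cases u rule: L2_cases) (simp add: restr.abs_eq L2_rel_refl abs_L2_zero)

lemma restr_add: "restr S (u + v) = restr S u + restr S v"
proof (cases "S \<in> sets lebesgue")
  case True
  obtain f where f: "square_integrable f" "u = abs_L2 f" by (rule L2_cases)
  obtain g where g: "square_integrable g" "v = abs_L2 g" by (rule L2_cases)
  have "(\<lambda>x. if x \<in> S then f x + g x else 0) = (\<lambda>x. (if x \<in> S then f x else 0) + (if x \<in> S then g x else 0))"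
    by auto
  with f g True show ?thesis
    using restr_abs_L2[OF square_integrable_add[OF f(1) g(1)] True]
    by (simp add: restr_abs_L2 plus_L2.abs_eq L2_rel_refl square_integrable_restrict)
qed (simp add: restr_non_measurable)

lemma restr_scaleR: "restr S (c *\<^sub>R u) = c *\<^sub>R restr S u"
proof (cases "S \<in> sets lebesgue")
  case True
  obtain f where f: "square_integrable f" "u = abs_L2 f" by (rule L2_cases)
  have "(\<lambda>x. if x \<in> S then c *\<^sub>R f x else 0) = (\<lambda>x. c *\<^sub>R (if x \<in> S then f x else 0))"
    by auto
  with f True show ?thesis
    using restr_abs_L2[OF square_integrable_scaleR[OF f(1)] True, of c]
    by (simp add: restr_abs_L2 scaleR_L2.abs_eq L2_rel_refl square_integrable_restrict)
qed (simp add: restr_non_measurable)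

lemma restr_Un:
  assumes "S \<in> sets lebesgue" "T \<in> sets lebesgue" "S \<inter> T = {}"
  shows "restr (S \<union> T) u = restr S u + restr T u"
proof (cases u rule: L2_cases)
  case (1 f)
  have "(\<lambda>x. if x \<in> S \<union> T then f x else 0) = (\<lambda>x. (if x \<in> S then f x else 0) + (if x \<in> T then f x else 0))"
    using assms(3) by (auto simp: fun_eq_iff)
  with 1 assms show ?thesis
    by (simp add: restr_abs_L2 plus_L2.abs_eq L2_rel_refl square_integrable_restrict)
qed

lemma restr_UN:
  assumes "finite I" "\<And>k. k \<in> I \<Longrightarrow> D k \<in> sets lebesgue" "disjoint_family_on D I"
  shows "restr (\<Union>k\<in>I. D k) u = (\<Sum>k\<in>I. restr (D k) u)"
  using assms
proof (induction I)
  case empty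
  have "restr {} u = 0"
    by (cases u rule: L2_cases) (simp add: restr_abs_L2 abs_L2_zero)
  then show ?case by simp
next
  case (insert k I)
  then have "disjoint_family_on D I" "D k \<inter> (\<Union>j\<in>I. D j) = {}"
    by (auto simp: disjoint_family_on_def)
  with insert show ?case
    using restr_Un[of "D k" "\<Union>j\<in>I. D j" u] by (auto simp: sets.finite_UN)
qed

lemma restr_eq_self:
  assumes "u \<in> L2_on S" "T \<in> sets lebesgue" "negligible (S - T)"
  shows "restr T u = u"
proof (cases u rule: L2_cases)
  case (1 f)
  have "AE x in lebesgue. x \<notin> S \<longrightarrow> f x = 0" using assms(1) 1 by (simp add: mem_L2_on_abs)
  moreover have "AE x in lebesgue. x \<notin> S - T"
    using assms(3) by (intro AE_not_in) (simp add: negligible_iff_null_sets)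
  ultimately have "AE x in lebesgue. (if x \<in> T then f x else 0) = f x"
    by eventually_elim auto
  with 1 assms(2) show ?thesis
    by (simp add: restr_abs_L2 abs_L2_eq_iff square_integrable_restrict)
qed

text \<open>A test field on D is also one on S, and it does not notice the restriction of u and g to
  D.\<close>

lemma has_weak_grad_restr:
  assumes "open D" "D \<subseteq> S" "has_weak_grad S u g"
  shows "has_weak_grad D (restr D u) (restr D g)"
  unfolding has_weak_grad_iff
proof (intro allI impI)
  fix \<phi> assume \<phi>: "test_field D \<phi>"
  have D: "D \<in> sets lebesgue" using assms(1) by auto
  have "restr D u \<bullet> abs_L2 (classical_div \<phi>) = u \<bullet> abs_L2 (classical_div \<phi>)"
    using test_function_classical_div[OF \<phi>]
    by (intro inner_restr D) (auto simp: test_function_square_integrable test_function_outside)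
  moreover have "restr D g \<bullet> abs_L2 \<phi> = g \<bullet> abs_L2 \<phi>"
    using \<phi> by (intro inner_restr D) (auto simp: test_field_square_integrable test_field_outside)
  ultimately show "restr D u \<bullet> abs_L2 (classical_div \<phi>) = - (restr D g \<bullet> abs_L2 \<phi>)"
    using assms(3) test_field_mono[OF \<phi> assms(2)] by (simp add: has_weak_grad_iff)
qed

lemma has_weak_curl_restr:
  assumes "open D" "D \<subseteq> S" "has_weak_curl S u c"
  shows "has_weak_curl D (restr D u) (restr D c)"
  unfolding has_weak_curl_iff
proof (intro allI impI)
  fix \<phi> assume \<phi>: "test_field D \<phi>"
  have D: "D \<in> sets lebesgue" using assms(1) by auto
  have "restr D u \<bullet> abs_L2 (classical_curl \<phi>) = u \<bullet> abs_L2 (classical_curl \<phi>)"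
    using test_field_classical_curl[OF \<phi>]
    by (intro inner_restr D) (auto simp: test_field_square_integrable test_field_outside)
  moreover have "restr D c \<bullet> abs_L2 \<phi> = c \<bullet> abs_L2 \<phi>"
    using \<phi> by (intro inner_restr D) (auto simp: test_field_square_integrable test_field_outside)
  ultimately show "restr D u \<bullet> abs_L2 (classical_curl \<phi>) = restr D c \<bullet> abs_L2 \<phi>"
    using assms(3) test_field_mono[OF \<phi> assms(2)] by (simp add: has_weak_curl_iff)
qed

lemma grad_restr:
  assumes "open D" "open S" "D \<subseteq> S" "u \<in> H1 S"
  shows "grad D (restr D u) = restr D (grad S u)"
  using assms has_weak_grad_restr[OF _ _ H1_grad(2)] restr_in_L2_on[of D] by (intro grad_eq) auto

lemma curl_restr:
  assumes "open D" "open S" "D \<subseteq> S" "u \<in> Hcurl S"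
  shows "curl D (restr D u) = restr D (curl S u)"
  using assms has_weak_curl_restr[OF _ _ Hcurl_curl(2)] restr_in_L2_on[of D] by (intro curl_eq) auto

section \<open>Finite dimension of the broken spaces, and their stability under gradient and
  curl\<close>

lemma finite_dim_subspace_imp_subspace: "finite_dim_subspace V \<Longrightarrow> subspace V"
  by (auto simp: finite_dim_subspace_def)

lemma finite_dim_subspace_subset:
  assumes "finite_dim_subspace U" "subspace W" "W \<subseteq> U"
  shows "finite_dim_subspace W"
proof -
  obtain B where B: "finite B" "span B = U" using assms(1) by (auto simp: finite_dim_subspace_def)
  obtain C where C: "C \<subseteq> W" "independent C" "W \<subseteq> span C"
    using maximal_independent_subset by blast
  have "finite C" using independent_span_bound[OF B(1) C(2)] B(2) C(1) assms(3) by auto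
  moreover have "span C = W" using C assms(2) by (simp add: span_minimal subset_antisym)
  ultimately show ?thesis by (auto simp: finite_dim_subspace_def)
qed

lemma subspace_broken_space:
  assumes "\<And>k. k \<in> {1..K} \<Longrightarrow> subspace (V k)"
  shows "subspace (broken_space \<Omega> K D V)"
proof -
  have "restr S (0 :: 'a L2) = 0" for S
    using restr_scaleR[of S 0 0] by simp
  then show ?thesis
    using assms subspace_L2_on[of \<Omega>]
    by (auto simp: subspace_def broken_space_def restr_add restr_scaleR)
qed

text \<open>The interfaces are null sets, so a broken field is the sum of its restrictions to the
  subdomains, each of which lies in a local space with a finite spanning set.\<close>

lemma finite_dim_broken_space:
  assumes "is_domain \<Omega>" "subdomain_partition \<Omega> K D" "\<And>k. k \<in> {1..K} \<Longrightarrow> finite_dim_subspace (V k)"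
  shows "finite_dim_subspace (broken_space \<Omega> K D V)"
proof -
  have "\<forall>k\<in>{1..K}. \<exists>B. finite B \<and> span B = V k"
    using assms(3) by (auto simp: finite_dim_subspace_def)
  then obtain B where B: "\<And>k. k \<in> {1..K} \<Longrightarrow> finite (B k)" "\<And>k. k \<in> {1..K} \<Longrightarrow> span (B k) = V k"
    by metis
  let ?U = "\<Union>k\<in>{1..K}. D k"
  have D: "D k \<in> sets lebesgue" if "k \<in> {1..K}" for k
    using assms(2) that by (auto simp: subdomain_partition_def is_domain_def)
  \<comment> \<open>An inclusion suffices, since subspaces inherit finite dimension. Equality could
    fail here: elements of \<open>V k\<close> are not assumed to vanish outside
    \<open>D k\<close>.\<close>
  have "broken_space \<Omega> K D V \<subseteq> span (\<Union>k\<in>{1..K}. B k)"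
  proof
    fix v assume v: "v \<in> broken_space \<Omega> K D V"
    have "?U \<in> sets lebesgue" using D by (intro sets.finite_UN) auto
    then have "v = restr ?U v"
      using v assms(2) by (intro restr_eq_self[symmetric]) (auto simp: broken_space_def subdomain_partition_def)
    also have "\<dots> = (\<Sum>k\<in>{1..K}. restr (D k) v)"
      using assms(2) D by (intro restr_UN) (auto simp: subdomain_partition_def)
    also have "\<dots> \<in> span (\<Union>k\<in>{1..K}. B k)"
    proof (rule span_sum)
      fix k assume k: "k \<in> {1..K}"
      then have "restr (D k) v \<in> span (B k)" using v B by (auto simp: broken_space_def)
      then show "restr (D k) v \<in> span (\<Union>k\<in>{1..K}. B k)"
        using k span_mono[of "B k" "\<Union>k\<in>{1..K}. B k"] by blast
    qed
    finally show "v \<in> span (\<Union>k\<in>{1..K}. B k)" .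
  qed
  moreover have "finite_dim_subspace (span (\<Union>k\<in>{1..K}. B k))"
    using B(1) unfolding finite_dim_subspace_def by (intro exI[of _ "\<Union>k\<in>{1..K}. B k"]) auto
  ultimately show ?thesis
    using subspace_broken_space[of K V \<Omega> D] assms(3) finite_dim_subspace_imp_subspace
      finite_dim_subspace_subset by blast
qed

text \<open>By \<open>grad_restr\<close> the global gradient restricts to the local one, so the
  local inclusion can be applied on each subdomain.\<close>

lemma grad_broken_space:
  assumes "is_domain \<Omega>" "subdomain_partition \<Omega> K D"
    and "\<And>k. k \<in> {1..K} \<Longrightarrow> grad (D k) ` V0 k \<subseteq> V1 k"
    and q: "q \<in> broken_space \<Omega> K D V0" "q \<in> H1 \<Omega>"
  shows "grad \<Omega> q \<in> broken_space \<Omega> K D V1"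
  unfolding broken_space_def
proof (intro CollectI conjI ballI)
  have o: "open \<Omega>" using assms(1) by (simp add: is_domain_def)
  show "grad \<Omega> q \<in> L2_on \<Omega>" by (rule H1_grad(1)[OF o q(2)])
  fix k assume k: "k \<in> {1..K}"
  then have "open (D k)" "D k \<subseteq> \<Omega>"
    using assms(2) by (auto simp: subdomain_partition_def is_domain_def)
  then have "restr (D k) (grad \<Omega> q) = grad (D k) (restr (D k) q)"
    by (simp add: grad_restr[OF _ o _ q(2)])
  then show "restr (D k) (grad \<Omega> q) \<in> V1 k"
    using assms(3) k q by (force simp: broken_space_def)
qed

lemma curl_broken_space:
  assumes "is_domain \<Omega>" "subdomain_partition \<Omega> K D"
    and "\<And>k. k \<in> {1..K} \<Longrightarrow> curl (D k) ` V1 k \<subseteq> V2 k"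
    and v: "v \<in> broken_space \<Omega> K D V1" "v \<in> Hcurl \<Omega>"
  shows "curl \<Omega> v \<in> broken_space \<Omega> K D V2"
  unfolding broken_space_def
proof (intro CollectI conjI ballI)
  have o: "open \<Omega>" using assms(1) by (simp add: is_domain_def)
  show "curl \<Omega> v \<in> L2_on \<Omega>" by (rule Hcurl_curl(1)[OF o v(2)])
  fix k assume k: "k \<in> {1..K}"
  then have "open (D k)" "D k \<subseteq> \<Omega>"
    using assms(2) by (auto simp: subdomain_partition_def is_domain_def)
  then have "restr (D k) (curl \<Omega> v) = curl (D k) (restr (D k) v)"
    by (simp add: curl_restr[OF _ o _ v(2)])
  then show "restr (D k) (curl \<Omega> v) \<in> V2 k"
    using assms(3) k v by (force simp: broken_space_def)
qed

section \<open>The discrete magnetostatic problem\<close>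

text \<open>The Riesz representation with an explicit representer: over an orthogonal spanning set
  the Fourier coefficients are f c / (c . c).\<close>

lemma finite_dim_subspace_riesz:
  fixes U :: "'v::real_inner set" and f :: "'v \<Rightarrow> real"
  assumes U: "finite_dim_subspace U"
    and add: "\<And>u v. u \<in> U \<Longrightarrow> v \<in> U \<Longrightarrow> f (u + v) = f u + f v"
    and scale: "\<And>c v. v \<in> U \<Longrightarrow> f (c *\<^sub>R v) = c * f v"
  shows "\<exists>t\<in>U. \<forall>v\<in>U. t \<bullet> v = f v"
proof -
  obtain C where C: "finite C" "span C = U" "pairwise orthogonal C"
    using U basis_orthogonal unfolding finite_dim_subspace_def by metis
  let ?t = "\<Sum>c\<in>C. (f c / (c \<bullet> c)) *\<^sub>R c"
  \<comment> \<open>An orthogonal spanning set may contain 0. Its coefficient is a division by zero,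
    and \<open>f0\<close> settles the basis identity there.\<close>
  have f0: "f 0 = 0" using scale[of 0 0] C(2) span_zero[of C] by simp
  have "?t \<in> span C" by (intro span_sum span_scale span_base)
  have basis: "?t \<bullet> c = f c" if c: "c \<in> C" for c
  proof -
    have "?t \<bullet> c = (\<Sum>d\<in>C. if d = c then f c else 0)"
      unfolding inner_sum_left
    proof (rule sum.cong)
      fix d assume "d \<in> C"
      then show "(f d / (d \<bullet> d)) *\<^sub>R d \<bullet> c = (if d = c then f c else 0)"
        using C(3) c f0 by (cases "d = c"; cases "c = 0") (auto simp: pairwise_def orthogonal_def)
    qed simp
    also have "\<dots> = f c" using C(1) c by simp
    finally show ?thesis .
  qed
  \<comment> \<open>Membership in U is carried through the induction because f is additive and
    homogeneous only on U.\<close>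
  have "v \<in> U \<and> ?t \<bullet> v = f v" if "v \<in> span C" for v
    using that
  proof (induction rule: span_induct)
    case base
    show ?case
      using C(2) f0 by (auto simp: subspace_def add scale inner_add_right span_zero span_add span_scale)
  next
    case (step c)
    then show ?case using basis C(2) span_base by blast
  qed
  with \<open>?t \<in> span C\<close> C(2) show ?thesis by blast
qed

text \<open>The representer of v |-> x . v on U is the orthogonal projection of x.\<close>

lemma finite_dim_subspace_projection:
  fixes U :: "'v::real_inner set"
  assumes "finite_dim_subspace U"
  obtains t where "t \<in> U" "\<And>v. v \<in> U \<Longrightarrow> t \<bullet> v = x \<bullet> v"
  using finite_dim_subspace_riesz[OF assms, of "\<lambda>v. x \<bullet> v"] by (auto simp: inner_add_right)

lemma finite_dim_subspace_image:
  assumes U: "finite_dim_subspace U"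
    and add: "\<And>u v. u \<in> U \<Longrightarrow> v \<in> U \<Longrightarrow> f (u + v) = f u + f v"
    and scale: "\<And>c v. v \<in> U \<Longrightarrow> f (c *\<^sub>R v) = c *\<^sub>R f v"
  shows "finite_dim_subspace (f ` U)"
proof -
  obtain B where B: "finite B" "span B = U" using U by (auto simp: finite_dim_subspace_def)
  have sU: "subspace U" using U by (rule finite_dim_subspace_imp_subspace)
  have "f 0 = 0" using scale[of 0 0] subspace_0[OF sU] by simp
  have "subspace (f ` U)"
    unfolding subspace_def
  proof (intro conjI ballI allI)
    show "0 \<in> f ` U" using \<open>f 0 = 0\<close> subspace_0[OF sU] by (metis image_eqI)
    show "x + y \<in> f ` U" if xy: "x \<in> f ` U" "y \<in> f ` U" for x y
    proof -
      obtain u v where "u \<in> U" "x = f u" "v \<in> U" "y = f v" using xy by blast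
      then show ?thesis using add[of u v] subspace_add[OF sU, of u v] by (intro image_eqI[of _ _ "u + v"]) auto
    qed
    show "c *\<^sub>R x \<in> f ` U" if x: "x \<in> f ` U" for c x
    proof -
      obtain u where "u \<in> U" "x = f u" using x by blast
      then show ?thesis using scale[of u c] subspace_scale[OF sU, of u c] by (intro image_eqI[of _ _ "c *\<^sub>R u"]) auto
    qed
  qed
  moreover have "f v \<in> span (f ` B)" if "v \<in> U" for v
  proof -
    have "v \<in> span B" using that B(2) by simp
    then have "v \<in> U \<and> f v \<in> span (f ` B)"
    proof (induction rule: span_induct)
      case base
      show ?case
        using sU \<open>f 0 = 0\<close> by (auto simp: subspace_def add scale span_zero span_add span_scale)
    next
      case (step c)
      then have "c \<in> U" "f c \<in> f ` B" using B(2) span_base by auto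
      then show ?case using span_base by simp
    qed
    then show ?thesis ..
  qed
  moreover have "f ` B \<subseteq> f ` U" unfolding B(2)[symmetric] by (rule image_mono[OF span_superset])
  ultimately have "span (f ` B) = f ` U"
    by (intro subset_antisym span_minimal) auto
  with B(1) show ?thesis
    unfolding finite_dim_subspace_def by (intro exI[of _ "f ` B"]) simp
qed

section \<open>Linear projections and adjoints relative to a subspace\<close>

lemma linear_projection_mem: "linear_projection V U P \<Longrightarrow> v \<in> V \<Longrightarrow> P v \<in> U"
  by (auto simp: linear_projection_def)

lemma linear_projection_fixes: "linear_projection V U P \<Longrightarrow> u \<in> U \<Longrightarrow> P u = u"
  by (auto simp: linear_projection_def)

lemma linear_projection_complement:
  assumes "linear_projection V U P" "subspace V" "U \<subseteq> V" "v \<in> V"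
  shows "P (v - P v) = 0"
proof -
  have Pv: "P v \<in> V" using assms linear_projection_mem by blast
  have "P (v + (-1) *\<^sub>R P v) = P v + P ((-1) *\<^sub>R P v)"
    using assms(1,4) subspace_scale[OF assms(2) Pv, of "-1"] by (simp only: linear_projection_def)
  also have "P ((-1) *\<^sub>R P v) = (-1) *\<^sub>R P (P v)"
    using assms(1) Pv unfolding linear_projection_def by blast
  also have "P (P v) = P v" using assms(1,4) by (simp add: linear_projection_def)
  finally show ?thesis by simp
qed

text \<open>Existence is the Riesz representation of v |-> w . A v; two representers differ by an
  element of U that is orthogonal to itself.\<close>

lemma adjoint_on_mem_inner:
  assumes U: "finite_dim_subspace U"
    and add: "\<And>u v. u \<in> U \<Longrightarrow> v \<in> U \<Longrightarrow> A (u + v) = A u + A v"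
    and scale: "\<And>c v. v \<in> U \<Longrightarrow> A (c *\<^sub>R v) = c *\<^sub>R A v"
  shows "adjoint_on U A w \<in> U" "v \<in> U \<Longrightarrow> adjoint_on U A w \<bullet> v = w \<bullet> A v"
    and adjoint_on_eqI: "\<And>t. t \<in> U \<Longrightarrow> (\<And>v. v \<in> U \<Longrightarrow> t \<bullet> v = w \<bullet> A v) \<Longrightarrow> adjoint_on U A w = t"
proof -
  have uniq: "t = t'" if "t \<in> U \<and> (\<forall>v\<in>U. t \<bullet> v = w \<bullet> A v)" "t' \<in> U \<and> (\<forall>v\<in>U. t' \<bullet> v = w \<bullet> A v)" for t t'
  proof -
    have "t - t' \<in> U" using that U by (simp add: finite_dim_subspace_imp_subspace subspace_diff)
    then have "(t - t') \<bullet> (t - t') = 0" using that by (simp add: inner_diff_left)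
    then show ?thesis by simp
  qed
  have "\<exists>t\<in>U. \<forall>v\<in>U. t \<bullet> v = w \<bullet> A v"
    by (rule finite_dim_subspace_riesz[OF U]) (simp_all add: add scale inner_add_right)
  then obtain t where t: "t \<in> U \<and> (\<forall>v\<in>U. t \<bullet> v = w \<bullet> A v)" by blast
  show eqI: "adjoint_on U A w = t" if "t \<in> U" "\<And>v. v \<in> U \<Longrightarrow> t \<bullet> v = w \<bullet> A v" for t
    unfolding adjoint_on_def by (rule the_equality) (use that in \<open>auto intro: uniq\<close>)
  have "adjoint_on U A w = t" using t by (intro eqI) auto
  with t show "adjoint_on U A w \<in> U" "v \<in> U \<Longrightarrow> adjoint_on U A w \<bullet> v = w \<bullet> A v" by auto
qed

text \<open>Isolates what the linear algebra requires of the discrete complex. Linearity of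
  \<open>grad\<close> and \<open>curl\<close> is demanded only on the conforming spaces, outside of
  which their values may be meaningless.\<close>

locale conforming_complex =
  fixes \<Omega> :: "(real^3) set" and V0h V0c :: "real L2 set" and V1h V1c V2c H :: "(real^3) L2 set"
  assumes subspace_V0h: "subspace V0h" and subspace_V1h: "subspace V1h"
    and finite_dim_V0c: "finite_dim_subspace V0c" and finite_dim_V1c: "finite_dim_subspace V1c"
    and V0c_subset: "V0c \<subseteq> V0h" and V1c_subset: "V1c \<subseteq> V1h"
    and grad_linear: "\<And>p q. p \<in> V0c \<Longrightarrow> q \<in> V0c \<Longrightarrow> grad \<Omega> (p + q) = grad \<Omega> p + grad \<Omega> q"
      "\<And>c q. q \<in> V0c \<Longrightarrow> grad \<Omega> (c *\<^sub>R q) = c *\<^sub>R grad \<Omega> q"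
    and curl_linear: "\<And>u v. u \<in> V1c \<Longrightarrow> v \<in> V1c \<Longrightarrow> curl \<Omega> (u + v) = curl \<Omega> u + curl \<Omega> v"
      "\<And>c v. v \<in> V1c \<Longrightarrow> curl \<Omega> (c *\<^sub>R v) = c *\<^sub>R curl \<Omega> v"
    and grad_V1c: "\<And>q. q \<in> V0c \<Longrightarrow> grad \<Omega> q \<in> V1c"
    and curl_grad_0: "\<And>q. q \<in> V0c \<Longrightarrow> curl \<Omega> (grad \<Omega> q) = 0"
    and curl_V2c: "\<And>v. v \<in> V1c \<Longrightarrow> curl \<Omega> v \<in> V2c"
    and H_def: "H = harmonic_fields \<Omega> V0c V1c"
begin

abbreviation adj where "adj \<equiv> adjoint_on V1c (curl \<Omega>)"

text \<open>The reduced problem: the last clause is the normal equation for the least-squares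
  problem curl B = J over \<open>V1c\<close>, and the middle one selects its solution of least
  norm.\<close>

definition curl_solution :: "(real^3) L2 \<Rightarrow> (real^3) L2 \<Rightarrow> bool" where
  "curl_solution J B \<longleftrightarrow> B \<in> V1c \<and> (\<forall>v\<in>V1c. curl \<Omega> v = 0 \<longrightarrow> v \<bullet> B = 0) \<and>
     (\<forall>v\<in>V1c. curl \<Omega> v \<bullet> curl \<Omega> B = curl \<Omega> v \<bullet> J)"

lemmas subspace_V1c = finite_dim_subspace_imp_subspace[OF finite_dim_V1c]
lemmas subspace_V0c = finite_dim_subspace_imp_subspace[OF finite_dim_V0c]

lemma curl_diff:
  assumes "u \<in> V1c" "v \<in> V1c"
  shows "curl \<Omega> (u - v) = curl \<Omega> u - curl \<Omega> v"
  using curl_linear(1)[OF assms(1) subspace_scale[OF subspace_V1c assms(2), of "-1"]]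
    curl_linear(2)[OF assms(2), of "-1"] by simp

lemma curl_0: "curl \<Omega> 0 = 0" and grad_0: "grad \<Omega> 0 = 0"
  using curl_linear(2)[of 0 0] grad_linear(2)[of 0 0] subspace_0[OF subspace_V1c] subspace_0[OF subspace_V0c]
  by simp_all

lemma finite_dim_grad: "finite_dim_subspace (grad \<Omega> ` V0c)"
  by (rule finite_dim_subspace_image[OF finite_dim_V0c]) (simp_all add: grad_linear)

lemma finite_dim_curl: "finite_dim_subspace (curl \<Omega> ` V1c)"
  by (rule finite_dim_subspace_image[OF finite_dim_V1c]) (simp_all add: curl_linear)

lemma harmonic_iff: "v \<in> H \<longleftrightarrow> v \<in> V1c \<and> curl \<Omega> v = 0 \<and> (\<forall>q\<in>V0c. grad \<Omega> q \<bullet> v = 0)"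
  by (simp add: H_def harmonic_fields_def)

text \<open>A curl-free conforming field minus its orthogonal projection onto the gradients is still
  curl-free and is orthogonal to all gradients, hence harmonic.\<close>

lemma kernel_orthogonal_iff:
  "(\<forall>v\<in>V1c. curl \<Omega> v = 0 \<longrightarrow> v \<bullet> B = 0) \<longleftrightarrow> (\<forall>q\<in>V0c. grad \<Omega> q \<bullet> B = 0) \<and> (\<forall>w\<in>H. w \<bullet> B = 0)"
proof (intro iffI ballI impI; (elim conjE)?)
  assume "\<forall>v\<in>V1c. curl \<Omega> v = 0 \<longrightarrow> v \<bullet> B = 0"
  then show "(\<forall>q\<in>V0c. grad \<Omega> q \<bullet> B = 0) \<and> (\<forall>w\<in>H. w \<bullet> B = 0)"
    using grad_V1c curl_grad_0 harmonic_iff by blast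
next
  fix v
  assume B: "\<forall>q\<in>V0c. grad \<Omega> q \<bullet> B = 0" "\<forall>w\<in>H. w \<bullet> B = 0" and v: "v \<in> V1c" "curl \<Omega> v = 0"
  obtain g where g: "g \<in> grad \<Omega> ` V0c" "\<And>w. w \<in> grad \<Omega> ` V0c \<Longrightarrow> g \<bullet> w = v \<bullet> w"
    by (rule finite_dim_subspace_projection[OF finite_dim_grad, of v]) blast
  have "g \<in> V1c" "curl \<Omega> g = 0" using g(1) grad_V1c curl_grad_0 by auto
  then have "v - g \<in> H"
    using v g(2) by (auto simp: harmonic_iff curl_diff subspace_diff[OF subspace_V1c] inner_diff_right inner_commute[of "grad \<Omega> _"])
  moreover have "g \<bullet> B = 0" using g(1) B(1) by auto
  ultimately show "v \<bullet> B = 0" using B(2) by (force simp: inner_diff_left)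
qed

text \<open>The curl of the difference is orthogonal to itself, so the difference lies in the
  kernel, to which it is also orthogonal.\<close>

lemma curl_solution_unique:
  assumes "curl_solution J B" "curl_solution J B'"
  shows "B = B'"
proof -
  let ?d = "B - B'"
  have V: "B \<in> V1c" "B' \<in> V1c" "?d \<in> V1c"
    using assms by (auto simp: curl_solution_def subspace_diff[OF subspace_V1c])
  have "curl \<Omega> ?d \<bullet> curl \<Omega> ?d = curl \<Omega> ?d \<bullet> curl \<Omega> B - curl \<Omega> ?d \<bullet> curl \<Omega> B'"
    using V by (simp add: curl_diff inner_diff_right)
  also have "\<dots> = 0" using assms V by (simp add: curl_solution_def)
  finally have "curl \<Omega> ?d = 0" by simp
  then have "?d \<bullet> ?d = 0" using assms V by (simp add: curl_solution_def inner_diff_right)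
  then show ?thesis by simp
qed

text \<open>Take any b whose curl is the projection of J onto the discrete curls. Subtracting the
  projection of b onto the kernel makes it orthogonal to the kernel without changing its
  curl.\<close>

lemma curl_solution_exists: "\<exists>B. curl_solution J B"
proof -
  let ?N = "{v \<in> V1c. curl \<Omega> v = 0}"
  obtain j where j: "j \<in> curl \<Omega> ` V1c" "\<And>w. w \<in> curl \<Omega> ` V1c \<Longrightarrow> j \<bullet> w = J \<bullet> w"
    by (rule finite_dim_subspace_projection[OF finite_dim_curl, of J]) blast
  obtain b where b: "b \<in> V1c" "j = curl \<Omega> b" using j(1) by blast
  have "subspace ?N"
    using subspace_V1c by (auto simp: subspace_def curl_linear curl_0)
  then have "finite_dim_subspace ?N"
    by (rule finite_dim_subspace_subset[OF finite_dim_V1c]) auto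
  then obtain n where n: "n \<in> ?N" "\<And>v. v \<in> ?N \<Longrightarrow> n \<bullet> v = b \<bullet> v"
    by (rule finite_dim_subspace_projection[of ?N b]) blast
  have "curl_solution J (b - n)"
    unfolding curl_solution_def
  proof (intro conjI ballI impI)
    show "b - n \<in> V1c" using b n by (simp add: subspace_diff[OF subspace_V1c])
    show "v \<bullet> (b - n) = 0" if "v \<in> V1c" "curl \<Omega> v = 0" for v
      using n(2)[of v] that by (simp add: inner_diff_right inner_commute)
    show "curl \<Omega> v \<bullet> curl \<Omega> (b - n) = curl \<Omega> v \<bullet> J" if "v \<in> V1c" for v
      using b n(1) j(2)[of "curl \<Omega> v"] that by (simp add: curl_diff inner_commute)
  qed
  then show ?thesis ..
qed

text \<open>The right-hand side contains neither parameters nor projections, so independence of them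
  follows at once, and well-posedness reduces to that of \<open>curl_solution\<close>.\<close>

lemma magnetostatic_solution_iff:
  assumes P0: "linear_projection V0h V0c P0" and P1: "linear_projection V1h V1c P1"
    and "\<alpha>0 > 0" "\<alpha>1 \<noteq> 0"
  shows "magnetostatic_solution \<Omega> V0h V1h H J \<alpha>0 \<alpha>1 P0 P1 (p, B, z) \<longleftrightarrow>
    p = 0 \<and> z = 0 \<and> curl_solution J B"
proof (intro iffI; (elim conjE)?)
  assume sol: "magnetostatic_solution \<Omega> V0h V1h H J \<alpha>0 \<alpha>1 P0 P1 (p, B, z)"
  then have mem: "p \<in> V0h" "B \<in> V1h" "z \<in> H"
    and eq0: "\<And>q. q \<in> V0h \<Longrightarrow>
      q \<bullet> p + \<alpha>0 * ((q - P0 q) \<bullet> (p - P0 p)) + grad \<Omega> (P0 q) \<bullet> B = 0"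
    and eq1: "\<And>v. v \<in> V1h \<Longrightarrow>
      v \<bullet> grad \<Omega> (P0 p) + curl \<Omega> (P1 v) \<bullet> curl \<Omega> (P1 B)
         + \<alpha>1 * ((v - P1 v) \<bullet> (B - P1 B)) + v \<bullet> z = curl \<Omega> (P1 v) \<bullet> J"
    and eqH: "\<And>w. w \<in> H \<Longrightarrow> w \<bullet> B = 0"
    unfolding magnetostatic_solution_def by auto
  \<comment> \<open>A conforming v is fixed by \<open>P1\<close>, so its stabilization term is zero
    whatever \<open>\<alpha>1\<close> is.\<close>
  have conf: "v \<bullet> grad \<Omega> (P0 p) + curl \<Omega> v \<bullet> curl \<Omega> (P1 B) + v \<bullet> z = curl \<Omega> v \<bullet> J"
    if "v \<in> V1c" for v
    using eq1[of v] that V1c_subset linear_projection_fixes[OF P1 that] by auto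
  have P0p: "P0 p \<in> V0c" by (rule linear_projection_mem[OF P0 mem(1)])
  have "grad \<Omega> (P0 p) \<bullet> z = 0" using mem(3) P0p harmonic_iff by blast
  then have "grad \<Omega> (P0 p) \<bullet> grad \<Omega> (P0 p) = 0"
    using conf[OF grad_V1c[OF P0p]] curl_grad_0[OF P0p] by simp
  then have gp: "grad \<Omega> (P0 p) = 0" by simp
  have "z \<in> V1c" "curl \<Omega> z = 0" using mem(3) harmonic_iff by auto
  then have "z \<bullet> z = 0" using conf[of z] gp by simp
  then have z: "z = 0" by simp
  \<comment> \<open>With the gradient gone, the test q = p leaves a sum of two nonnegative terms.
    The sign of \<open>\<alpha>0\<close> enters here.\<close>
  have "p \<bullet> p + \<alpha>0 * ((p - P0 p) \<bullet> (p - P0 p)) = 0"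
    using eq0[OF mem(1)] gp by simp
  moreover have "0 \<le> \<alpha>0 * ((p - P0 p) \<bullet> (p - P0 p))" using \<open>\<alpha>0 > 0\<close> by simp
  moreover have "0 \<le> p \<bullet> p" by simp
  ultimately have "p \<bullet> p = 0" by linarith
  then have p: "p = 0" by simp
  have P1B: "P1 B \<in> V1c" by (rule linear_projection_mem[OF P1 mem(2)])
  then have "B - P1 B \<in> V1h" using mem(2) V1c_subset subspace_diff[OF subspace_V1h] by blast
  \<comment> \<open>Since \<open>P1\<close> kills this test field, both curl terms vanish and only
    \<open>\<alpha>1\<close> times a squared norm is left; a nonzero factor of either sign is then
    enough.\<close>
  moreover have "P1 (B - P1 B) = 0"
    by (rule linear_projection_complement[OF P1 subspace_V1h V1c_subset mem(2)])
  ultimately have "\<alpha>1 * ((B - P1 B) \<bullet> (B - P1 B)) = 0"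
    using eq1[of "B - P1 B"] gp z by (simp add: curl_0)
  then have B: "P1 B = B" using \<open>\<alpha>1 \<noteq> 0\<close> by simp
  have "P0 0 = 0" using linear_projection_fixes[OF P0 subspace_0[OF subspace_V0c]] .
  then have "grad \<Omega> q \<bullet> B = 0" if "q \<in> V0c" for q
    using eq0[of q] that V0c_subset linear_projection_fixes[OF P0 that] p by auto
  with eqH have "\<forall>v\<in>V1c. curl \<Omega> v = 0 \<longrightarrow> v \<bullet> B = 0"
    using kernel_orthogonal_iff by blast
  moreover have "curl \<Omega> v \<bullet> curl \<Omega> B = curl \<Omega> v \<bullet> J" if "v \<in> V1c" for v
    using conf[OF that] gp z B by simp
  ultimately show "p = 0 \<and> z = 0 \<and> curl_solution J B"
    using p z B P1B by (simp add: curl_solution_def)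
next
  assume p: "p = 0" and z: "z = 0" and B: "curl_solution J B"
  have P: "P0 0 = 0" "P1 B = B" "B \<in> V1c"
    using B linear_projection_fixes[OF P0 subspace_0[OF subspace_V0c]] linear_projection_fixes[OF P1, of B]
    by (auto simp: curl_solution_def)
  have orth: "\<forall>q\<in>V0c. grad \<Omega> q \<bullet> B = 0" "\<forall>w\<in>H. w \<bullet> B = 0"
    using B kernel_orthogonal_iff by (auto simp: curl_solution_def)
  have "0 \<in> H" using subspace_0[OF subspace_V1c] by (simp add: harmonic_iff curl_0)
  \<comment> \<open>For a broken v the second equation is the normal equation at the conforming
    field \<open>P1 v\<close>: the terms with p, z and B - P1 B are zero.\<close>
  then show "magnetostatic_solution \<Omega> V0h V1h H J \<alpha>0 \<alpha>1 P0 P1 (p, B, z)"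
    using P p z B orth V1c_subset subspace_0[OF subspace_V0h]
      linear_projection_mem[OF P0] linear_projection_mem[OF P1]
    by (auto simp: magnetostatic_solution_def grad_0 curl_solution_def)
qed

lemma ex1_magnetostatic_solution:
  assumes "linear_projection V0h V0c P0" "linear_projection V1h V1c P1" "\<alpha>0 > 0" "\<alpha>1 \<noteq> 0"
  shows "\<exists>!s. magnetostatic_solution \<Omega> V0h V1h H J \<alpha>0 \<alpha>1 P0 P1 s"
proof -
  obtain B where "curl_solution J B" using curl_solution_exists by blast
  then show ?thesis
    using curl_solution_unique
    by (intro ex1I[of _ "(0, B, 0)"]) (auto simp: magnetostatic_solution_iff[OF assms] split_paired_all)
qed

section \<open>The adjoint of the discrete curl and the Hodge components of the solution\<close>

lemma adj_mem: "adj w \<in> V1c" and adj_inner: "v \<in> V1c \<Longrightarrow> adj w \<bullet> v = w \<bullet> curl \<Omega> v"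
  by (rule adjoint_on_mem_inner[OF finite_dim_V1c]; simp add: curl_linear)+

lemma adj_kernel_orthogonal: "v \<in> V1c \<Longrightarrow> curl \<Omega> v = 0 \<Longrightarrow> v \<bullet> adj w = 0"
  using adj_inner[of v w] by (simp add: inner_commute)

text \<open>The functional curl v |-> B . v is well defined on the discrete curls because B is
  orthogonal to the kernel. Its Riesz representer w satisfies \<open>adj w = B\<close>.\<close>

lemma kernel_orthogonal_in_range_adj:
  assumes B: "B \<in> V1c" and orth: "\<forall>v\<in>V1c. curl \<Omega> v = 0 \<longrightarrow> v \<bullet> B = 0"
  shows "B \<in> adj ` V2c"
proof -
  \<comment> \<open>The chosen preimage is immaterial for arguments that are discrete curls: two
    preimages differ by a curl-free field.\<close>
  define f where "f w = B \<bullet> (SOME v. v \<in> V1c \<and> curl \<Omega> v = w)" for w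
  have f: "f (curl \<Omega> v) = B \<bullet> v" if v: "v \<in> V1c" for v
  proof -
    let ?u = "SOME u. u \<in> V1c \<and> curl \<Omega> u = curl \<Omega> v"
    have u: "?u \<in> V1c \<and> curl \<Omega> ?u = curl \<Omega> v" by (rule someI[of _ v]) (use v in simp)
    then have "(?u - v) \<bullet> B = 0"
      using v orth by (simp add: curl_diff subspace_diff[OF subspace_V1c])
    then show ?thesis by (simp add: f_def inner_diff_left inner_commute[of B])
  qed
  have "\<exists>w\<in>curl \<Omega> ` V1c. \<forall>y\<in>curl \<Omega> ` V1c. w \<bullet> y = f y"
  proof (rule finite_dim_subspace_riesz[OF finite_dim_curl])
    show "f (x + y) = f x + f y" if xy: "x \<in> curl \<Omega> ` V1c" "y \<in> curl \<Omega> ` V1c" for x y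
    proof -
      obtain u v where "u \<in> V1c" "x = curl \<Omega> u" "v \<in> V1c" "y = curl \<Omega> v" using xy by blast
      then show ?thesis
        using f[of "u + v"] by (simp add: f curl_linear subspace_add[OF subspace_V1c] inner_add_right)
    qed
    show "f (c *\<^sub>R y) = c * f y" if y: "y \<in> curl \<Omega> ` V1c" for c y
    proof -
      obtain v where "v \<in> V1c" "y = curl \<Omega> v" using y by blast
      then show ?thesis
        using f[of "c *\<^sub>R v"] by (simp add: f curl_linear subspace_scale[OF subspace_V1c])
    qed
  qed
  then obtain w where w: "w \<in> curl \<Omega> ` V1c" "\<And>v. v \<in> V1c \<Longrightarrow> w \<bullet> curl \<Omega> v = B \<bullet> v"
    using f by auto
  have "adj w = B"
    by (rule adjoint_on_eqI[OF finite_dim_V1c]) (simp_all add: curl_linear B w)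
  moreover have "w \<in> V2c" using w(1) curl_V2c by blast
  ultimately show ?thesis by blast
qed

lemma orthogonal_grad_harmonic: "orthogonal_sets (grad \<Omega> ` V0c) H"
  by (auto simp: orthogonal_sets_def orthogonal_def harmonic_iff)

lemma orthogonal_grad_adj: "orthogonal_sets (grad \<Omega> ` V0c) (adj ` V2c)"
  by (auto simp: orthogonal_sets_def orthogonal_def grad_V1c curl_grad_0 adj_kernel_orthogonal)

lemma orthogonal_harmonic_adj: "orthogonal_sets H (adj ` V2c)"
  by (auto simp: orthogonal_sets_def orthogonal_def harmonic_iff adj_kernel_orthogonal)

lemma curl_solution_orthogonal_comp:
  assumes "curl_solution J B"
  shows "B \<in> (H + grad \<Omega> ` V0c)\<^sup>\<bottom>"
  using assms kernel_orthogonal_iff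
  by (auto simp: curl_solution_def orthogonal_comp_def orthogonal_def set_plus_def inner_add_left)

text \<open>B is orthogonal to Bg and Bh, and the three summands are mutually orthogonal, so Bg and
  Bh are orthogonal to themselves. Conversely, an element of the range of \<open>adj\<close> is
  orthogonal to the kernel, so the curl condition makes Bc a reduced solution and uniqueness gives B
  = Bc.\<close>

lemma curl_solution_components:
  assumes B: "curl_solution J B"
    and Bg: "Bg \<in> grad \<Omega> ` V0c" and Bh: "Bh \<in> H" and Bc: "Bc \<in> adj ` V2c"
  shows "B = Bg + Bh + Bc \<longleftrightarrow>
    Bg = 0 \<and> Bh = 0 \<and> (\<forall>w\<in>curl \<Omega> ` V1c. w \<bullet> curl \<Omega> Bc = w \<bullet> J)"
proof
  have orth: "Bg \<bullet> B = 0" "Bh \<bullet> B = 0"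
    using B Bg Bh kernel_orthogonal_iff by (auto simp: curl_solution_def)
  assume sum: "B = Bg + Bh + Bc"
  have "Bg \<bullet> Bh = 0" "Bg \<bullet> Bc = 0" "Bh \<bullet> Bc = 0"
    using Bg Bh Bc orthogonal_grad_harmonic orthogonal_grad_adj orthogonal_harmonic_adj
    unfolding orthogonal_sets_def orthogonal_def by blast+
  with orth have "Bg \<bullet> Bg = 0" "Bh \<bullet> Bh = 0"
    unfolding sum by (simp_all add: inner_add_right inner_commute[of Bh Bg])
  then show "Bg = 0 \<and> Bh = 0 \<and> (\<forall>w\<in>curl \<Omega> ` V1c. w \<bullet> curl \<Omega> Bc = w \<bullet> J)"
    using sum B by (auto simp: curl_solution_def)
next
  assume "Bg = 0 \<and> Bh = 0 \<and> (\<forall>w\<in>curl \<Omega> ` V1c. w \<bullet> curl \<Omega> Bc = w \<bullet> J)"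
  moreover from this have "curl_solution J Bc"
    using Bc by (auto simp: curl_solution_def adj_mem adj_kernel_orthogonal)
  ultimately show "B = Bg + Bh + Bc"
    using curl_solution_unique[OF B] by simp
qed

lemma curl_solution_decomposition:
  assumes "curl_solution J B"
  shows "\<exists>Bg\<in>grad \<Omega> ` V0c. \<exists>Bh\<in>H. \<exists>Bc\<in>adj ` V2c. B = Bg + Bh + Bc"
proof -
  have "B \<in> adj ` V2c"
    using assms by (intro kernel_orthogonal_in_range_adj) (auto simp: curl_solution_def)
  moreover have "0 \<in> grad \<Omega> ` V0c" "0 \<in> H"
    using grad_0 subspace_0[OF subspace_V0c] subspace_0[OF subspace_V1c] by (force simp: harmonic_iff curl_0)+
  moreover have "B = 0 + 0 + B" by simp
  ultimately show ?thesis by blast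
qed

end

text \<open>The characterization of the components is an equivalence over all triples from the three
  subspaces, so it also yields their uniqueness. Independence of parameters and projections is
  stated as equality of the solution predicates.\<close>

theorem proposition3p7:
  fixes \<Omega> :: "(real^3) set" and K :: nat and D :: "nat \<Rightarrow> (real^3) set"
    and V0 :: "nat \<Rightarrow> real L2 set" and V1 V2 :: "nat \<Rightarrow> (real^3) L2 set"
    and V0h V0c :: "real L2 set" and V1h V2h V1c V2c H :: "(real^3) L2 set"
    and P0 :: "real L2 \<Rightarrow> real L2" and P1 :: "(real^3) L2 \<Rightarrow> (real^3) L2"
    and J :: "(real^3) L2" and \<alpha>0 \<alpha>1 :: real
  assumes "is_domain \<Omega>" and "subdomain_partition \<Omega> K D"
    and "\<And>k. k \<in> {1..K} \<Longrightarrow> finite_dim_subspace (V0 k) \<and> V0 k \<subseteq> H1 (D k)"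
    and "\<And>k. k \<in> {1..K} \<Longrightarrow> finite_dim_subspace (V1 k) \<and> V1 k \<subseteq> Hcurl (D k)"
    and "\<And>k. k \<in> {1..K} \<Longrightarrow> finite_dim_subspace (V2 k) \<and> V2 k \<subseteq> Hdiv (D k)"
    and "\<And>k. k \<in> {1..K} \<Longrightarrow> grad (D k) ` V0 k \<subseteq> V1 k"
    and "\<And>k. k \<in> {1..K} \<Longrightarrow> curl (D k) ` V1 k \<subseteq> V2 k"
    and "V0h = broken_space \<Omega> K D V0"
    and "V1h = broken_space \<Omega> K D V1"
    and "V2h = broken_space \<Omega> K D V2"
    and "V0c = V0h \<inter> H1 \<Omega>"
    and "V1c = V1h \<inter> Hcurl \<Omega>"
    and "V2c = V2h \<inter> Hdiv \<Omega>"
    and "H = harmonic_fields \<Omega> V0c V1c"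
    and "linear_projection V0h V0c P0"
    and "linear_projection V1h V1c P1"
    and "J \<in> L2_on \<Omega>"
    and "\<alpha>0 > 0" and "\<alpha>1 \<noteq> 0"
  shows
    "(\<exists>!s. magnetostatic_solution \<Omega> V0h V1h H J \<alpha>0 \<alpha>1 P0 P1 s) \<and>
     (\<forall>p B z. magnetostatic_solution \<Omega> V0h V1h H J \<alpha>0 \<alpha>1 P0 P1 (p, B, z) \<longrightarrow>
        B \<in> V1c \<inter> (H + grad \<Omega> ` V0c)\<^sup>\<bottom> \<and> p = 0 \<and> z = 0 \<and>
        (\<exists>Bg\<in>grad \<Omega> ` V0c. \<exists>Bh\<in>H. \<exists>Bc\<in>adjoint_on V1c (curl \<Omega>) ` V2c. B = Bg + Bh + Bc) \<and>
        (\<forall>Bg\<in>grad \<Omega> ` V0c. \<forall>Bh\<in>H. \<forall>Bc\<in>adjoint_on V1c (curl \<Omega>) ` V2c.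
           B = Bg + Bh + Bc \<longleftrightarrow>
             Bg = 0 \<and> Bh = 0 \<and> (\<forall>w\<in>curl \<Omega> ` V1c. w \<bullet> curl \<Omega> Bc = w \<bullet> J))) \<and>
     orthogonal_sets (grad \<Omega> ` V0c) H \<and>
     orthogonal_sets (grad \<Omega> ` V0c) (adjoint_on V1c (curl \<Omega>) ` V2c) \<and>
     orthogonal_sets H (adjoint_on V1c (curl \<Omega>) ` V2c) \<and>
     (\<forall>\<alpha>0' \<alpha>1' P0' P1'. \<alpha>0' > 0 \<longrightarrow> \<alpha>1' \<noteq> 0 \<longrightarrow>
        linear_projection V0h V0c P0' \<longrightarrow> linear_projection V1h V1c P1' \<longrightarrow>
        (\<forall>s. magnetostatic_solution \<Omega> V0h V1h H J \<alpha>0' \<alpha>1' P0' P1' s \<longleftrightarrow>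
             magnetostatic_solution \<Omega> V0h V1h H J \<alpha>0 \<alpha>1 P0 P1 s))"
proof -
  have o: "open \<Omega>" using assms(1) by (simp add: is_domain_def)
  have V0h: "finite_dim_subspace V0h" and V1h: "finite_dim_subspace V1h"
    using finite_dim_broken_space[OF assms(1,2)] assms(3,4,8,9) by blast+
  note sub = V0h[THEN finite_dim_subspace_imp_subspace] V1h[THEN finite_dim_subspace_imp_subspace]
  interpret conforming_complex \<Omega> V0h V0c V1h V1c V2c H
  proof
    show "finite_dim_subspace V0c"
      using sub(1) subspace_H1[OF o] unfolding assms(11)
      by (intro finite_dim_subspace_subset[OF V0h] subspace_inter) auto
    show "finite_dim_subspace V1c"
      using sub(2) subspace_Hcurl[OF o] unfolding assms(12)
      by (intro finite_dim_subspace_subset[OF V1h] subspace_inter) auto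
    \<comment> \<open>A discrete gradient is conforming for two separate reasons: its weak curl
      exists and is zero, and on each subdomain it is a local gradient.\<close>
    show "grad \<Omega> q \<in> V1c" if "q \<in> V0c" for q
      using that curl_grad(1)[OF o, of q] grad_broken_space[OF assms(1,2,6), where q = q]
      unfolding assms(8,9,11,12) by blast
    show "curl \<Omega> v \<in> V2c" if "v \<in> V1c" for v
      using that curl_in_Hdiv[OF o, of v] curl_broken_space[OF assms(1,2,7), where v = v]
      unfolding assms(9,10,12,13) by blast
  qed (use sub assms(11,12,14) o in \<open>auto simp: H1_add H1_scaleR Hcurl_add Hcurl_scaleR curl_grad\<close>)
  have iff: "magnetostatic_solution \<Omega> V0h V1h H J \<alpha>0' \<alpha>1' P0' P1' (p, B, z) \<longleftrightarrow>
      p = 0 \<and> z = 0 \<and> curl_solution J B"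
    if "\<alpha>0' > 0" "\<alpha>1' \<noteq> 0" "linear_projection V0h V0c P0'" "linear_projection V1h V1c P1'"
    for \<alpha>0' \<alpha>1' P0' P1' p B z
    using magnetostatic_solution_iff that by blast
  note sol = iff[OF assms(18,19,15,16)]
  show ?thesis
  proof (intro conjI allI impI)
    show "\<exists>!s. magnetostatic_solution \<Omega> V0h V1h H J \<alpha>0 \<alpha>1 P0 P1 s"
      by (rule ex1_magnetostatic_solution[OF assms(15,16,18,19)])
  next
    fix p B z
    assume "magnetostatic_solution \<Omega> V0h V1h H J \<alpha>0 \<alpha>1 P0 P1 (p, B, z)"
    then have "p = 0" "z = 0" and B: "curl_solution J B" by (simp_all add: sol)
    then show "p = 0" "z = 0" by simp_all
    show "B \<in> V1c \<inter> (H + grad \<Omega> ` V0c)\<^sup>\<bottom>"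
      using B curl_solution_orthogonal_comp by (simp add: curl_solution_def)
    show "\<exists>Bg\<in>grad \<Omega> ` V0c. \<exists>Bh\<in>H. \<exists>Bc\<in>adj ` V2c. B = Bg + Bh + Bc"
      by (rule curl_solution_decomposition[OF B])
    show "\<forall>Bg\<in>grad \<Omega> ` V0c. \<forall>Bh\<in>H. \<forall>Bc\<in>adj ` V2c. B = Bg + Bh + Bc \<longleftrightarrow>
        Bg = 0 \<and> Bh = 0 \<and> (\<forall>w\<in>curl \<Omega> ` V1c. w \<bullet> curl \<Omega> Bc = w \<bullet> J)"
      using curl_solution_components[OF B] by (intro ballI)
  next
    show "orthogonal_sets (grad \<Omega> ` V0c) H" by (rule orthogonal_grad_harmonic)
    show "orthogonal_sets (grad \<Omega> ` V0c) (adj ` V2c)" by (rule orthogonal_grad_adj)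
    show "orthogonal_sets H (adj ` V2c)" by (rule orthogonal_harmonic_adj)
  next
    fix \<alpha>0' \<alpha>1' :: real and P0' P1' s
    assume "\<alpha>0' > 0" "\<alpha>1' \<noteq> 0" "linear_projection V0h V0c P0'" "linear_projection V1h V1c P1'"
    then show "magnetostatic_solution \<Omega> V0h V1h H J \<alpha>0' \<alpha>1' P0' P1' s \<longleftrightarrow>
        magnetostatic_solution \<Omega> V0h V1h H J \<alpha>0 \<alpha>1 P0 P1 s"
      by (cases s) (simp add: iff sol)
  qed
qed

end
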